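(* Let $(T,h)$, $(M,\varphi)$ be Riemannian manifolds and let $X^{(i)}_{(\alpha)}(t^\gamma,x^k)$ be a d-tensor field on $J^1(T,M)$ not depending on $x^m_\mu$. Consider the associated space $PDEsEDML^n_p$. (i) The electromagnetic distinguished 2-form of $PDEsEDML^n_p$ is $F=F^{(\alpha)}_{(i)j}\,\delta x^i_\alpha\wedge dx^j$, where $$F^{(\alpha)}_{(i)j}=\frac{h^{\alpha\mu}}{2}\left[\varphi_{im}X^{(m)}_{(\mu)\Vert j}-\varphi_{jm}X^{(m)}_{(\mu)\Vert i}\right].$$ (ii) The electromagnetic components $F^{(\alpha)}_{(i)j}$ satisfy the generalized Maxwell equations $$F^{(\alpha)}_{(i)j//\beta}=\tfrac14\mathcal{A}_{\{i,j\}}\left\{h^{\alpha\mu}\varphi_{im}\left[X^{(m)}_{(\mu)\Vert j//\beta}-\varphi^{mr}X^{(s)}_{(\mu)\Vert r//\beta}\varphi_{sj}\right]\right\},$$ $$\sum_{\{i,j,k\}}F^{(\alpha)}_{(i)j\Vert k}=0,\qquad \sum_{\{i,j,k\}}F^{(\alpha)}_{(i)j}\Vert^{(\gamma)}_{(k)}=0.$$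
   Context: $T$, $M$ are smooth connected manifolds of dimensions $p$, $n$ with local coordinates $(t^\alpha)$, $(x^i)$; $J^1(T,M)$ has local coordinates $(t^\alpha,x^i,x^i_\alpha)$. Summation over repeated indices is understood. $H^\gamma_{\alpha\beta}$, $\gamma^i_{jk}$ are the Christoffel symbols of $h$, $\varphi$; $h^{\alpha\beta}$, $\varphi^{ij}$ are the inverse metrics. A d-tensor $X^{(i)}_{(\alpha)}$ is a family of smooth local components transforming like those of a vertical vector field $X^{(i)}_{(\alpha)}\partial/\partial x^i_\alpha$. Covariant derivatives for objects independent of $x^m_\mu$: $X^{(i)}_{(\alpha)\Vert j}=\frac{\partial X^{(i)}_{(\alpha)}}{\partial x^j}+X^{(m)}_{(\alpha)}\gamma^i_{mj}$; $X^{(i)}_{(\alpha)\Vert j//\beta}=\frac{\partial X^{(i)}_{(\alpha)\Vert j}}{\partial t^\beta}-X^{(i)}_{(\mu)\Vert j}H^\mu_{\alpha\beta}$; $F^{(\alpha)}_{(i)j//\beta}=\frac{\partial F^{(\alpha)}_{(i)j}}{\partial t^\beta}+F^{(\mu)}_{(i)j}H^\alpha_{\mu\beta}$; $F^{(\alpha)}_{(i)j\Vert k}=\frac{\partial F^{(\alpha)}_{(i)j}}{\partial x^k}-F^{(\alpha)}_{(m)j}\gamma^m_{ik}-F^{(\alpha)}_{(i)m}\gamma^m_{jk}$; $F^{(\alpha)}_{(i)j}\Vert^{(\gamma)}_{(k)}=\partial F^{(\alpha)}_{(i)j}/\partial x^k_\gamma$. $\mathcal{A}_{\{i,j\}}\{E_{ij}\}=E_{ij}-E_{ji}$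 is the alternate sum and $\sum_{\{i,j,k\}}$ is the cyclic sum. The space $PDEsEDML^n_p$ attached to the PDE system $\partial x^i/\partial t^\alpha=X^{(i)}_{(\alpha)}(t,x(t))$ and the metrics $h,\varphi$ is the pair $(J^1(T,M),L)$ with $L=h^{\alpha\beta}\varphi_{ij}(x^i_\alpha-X^{(i)}_{(\alpha)})(x^j_\beta-X^{(j)}_{(\beta)})$. Its canonical nonlinear connection is $M^{(i)}_{(\alpha)\beta}=-H^\gamma_{\alpha\beta}x^i_\gamma$, $N^{(i)}_{(\alpha)j}=\gamma^i_{jk}x^k_\alpha-\frac12[X^{(i)}_{(\alpha)\Vert j}-\varphi^{ir}X^{(s)}_{(\alpha)\Vert r}\varphi_{sj}]$; put $\frac{\delta}{\delta x^j}=\frac{\partial}{\partial x^j}-N^{(l)}_{(\beta)j}\frac{\partial}{\partial x^l_\beta}$ and $\delta x^i_\alpha=dx^i_\alpha+M^{(i)}_{(\alpha)\beta}dt^\beta+N^{(i)}_{(\alpha)j}dx^j$. The generalized Cartan canonical connection has adapted components $(H^\gamma_{\alpha\beta},0,\gamma^i_{jk},0)$, so the horizontal deflection tensor is $x^m_{\mu|j}=\frac{\delta x^m_\mu}{\delta x^j}+x^l_\mu\gamma^m_{lj}$. With $D^{(\alpha)}_{(i)j}=h^{\alpha\mu}\varphi_{im}x^m_{\mu|j}$, the electromagnetic 2-form is defined as $F=F^{(\alpha)}_{(i)j}\delta x^i_\alpha\wedge dx^j$ with $F^{(\alpha)}_{(i)j}=\frac12[D^{(\alpha)}_{(i)j}-D^{(\alpha)}_{(j)i}]$.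 *)

theory Defs
  imports "HOL-Analysis.Analysis"
begin

section \<open>Smooth functions and partial derivatives\<close>

text \<open>The predicates below are meant for open sets only.\<close>

primrec Ck_on :: "nat \<Rightarrow> 'a::real_normed_vector set \<Rightarrow> ('a \<Rightarrow> 'b::real_normed_vector) \<Rightarrow> bool" where
  "Ck_on 0 S f \<longleftrightarrow> continuous_on S f"
| "Ck_on (Suc k) S f \<longleftrightarrow>
     (\<forall>x\<in>S. f differentiable (at x)) \<and> (\<forall>v. Ck_on k S (\<lambda>x. frechet_derivative f (at x) v))"

definition smooth_on :: "'a::real_normed_vector set \<Rightarrow> ('a \<Rightarrow> 'b::real_normed_vector) \<Rightarrow> bool" where
  "smooth_on S f \<longleftrightarrow> (\<forall>k. Ck_on k S f)"

definition partial :: "'k::finite \<Rightarrow> (real^'k \<Rightarrow> real) \<Rightarrow> real^'k \<Rightarrow> real" where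
  "partial k f x = frechet_derivative f (at x) (axis k 1)"

section \<open>Smooth manifolds\<close>

text \<open>A chart is a pair of its domain and its coordinate map; the values of the coordinate map
  outside the domain are irrelevant. The atlas need not be maximal.\<close>

type_synonym ('a, 'k) chart = "'a set \<times> ('a \<Rightarrow> real^'k)"

abbreviation cdom :: "('a, 'k::finite) chart \<Rightarrow> 'a set" where "cdom c \<equiv> fst c"
abbreviation cmap :: "('a, 'k::finite) chart \<Rightarrow> 'a \<Rightarrow> real^'k" where "cmap c \<equiv> snd c"
abbreviation cinv :: "('a, 'k::finite) chart \<Rightarrow> real^'k \<Rightarrow> 'a" where
  "cinv c \<equiv> inv_into (cdom c) (cmap c)"
abbreviation cimg :: "('a, 'k::finite) chart \<Rightarrow> (real^'k) set" where
  "cimg c \<equiv> cmap c ` cdom c"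

record ('a, 'k::finite) mfd =
  mtop :: "'a topology"
  atlas :: "('a, 'k) chart set"

definition smooth_manifold :: "('a, 'k::finite) mfd \<Rightarrow> bool" where
  "smooth_manifold M \<longleftrightarrow>
     Hausdorff_space (mtop M) \<and> second_countable (mtop M) \<and>
     (\<Union>c\<in>atlas M. cdom c) = topspace (mtop M) \<and>
     (\<forall>c\<in>atlas M. openin (mtop M) (cdom c) \<and> open (cimg c) \<and>
        homeomorphic_map (subtopology (mtop M) (cdom c)) (top_of_set (cimg c)) (cmap c)) \<and>
     (\<forall>c\<in>atlas M. \<forall>c'\<in>atlas M.
        smooth_on (cmap c ` (cdom c \<inter> cdom c')) (cmap c' \<circ> cinv c))"

definition connected_smooth_manifold :: "('a, 'k::finite) mfd \<Rightarrow> bool" where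
  "connected_smooth_manifold M \<longleftrightarrow>
     smooth_manifold M \<and> topspace (mtop M) \<noteq> {} \<and> connected_space (mtop M)"

text \<open>The entry in row \<open>k\<close> and column \<open>i\<close> of \<open>jacobian c c' p\<close> is the partial derivative
  of the \<open>k\<close>-th coordinate of \<open>c'\<close> with respect to the \<open>i\<close>-th coordinate of \<open>c\<close>, at the
  point \<open>p\<close>.\<close>

definition jacobian :: "('a, 'k::finite) chart \<Rightarrow> ('a, 'k) chart \<Rightarrow> 'a \<Rightarrow> real^'k^'k" where
  "jacobian c c' p = matrix (frechet_derivative (cmap c' \<circ> cinv c) (at (cmap c p)))"

section \<open>Riemannian metrics\<close>

text \<open>A metric is the family of its local component matrices, one for each chart, as functions of
  the coordinates.\<close>

type_synonym ('a, 'k) metric = "('a, 'k) chart \<Rightarrow> real^'k \<Rightarrow> real^'k^'k"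

definition riemannian_metric :: "('a, 'k::finite) mfd \<Rightarrow> ('a, 'k) metric \<Rightarrow> bool" where
  "riemannian_metric M g \<longleftrightarrow>
     (\<forall>c\<in>atlas M. smooth_on (cimg c) (g c) \<and>
        (\<forall>x\<in>cimg c. transpose (g c x) = g c x \<and> (\<forall>v. v \<noteq> 0 \<longrightarrow> v \<bullet> (g c x *v v) > 0))) \<and>
     (\<forall>c\<in>atlas M. \<forall>c'\<in>atlas M. \<forall>p\<in>cdom c \<inter> cdom c'. \<forall>i j.
        g c (cmap c p) $ i $ j =
          (\<Sum>k\<in>UNIV. \<Sum>l\<in>UNIV. g c' (cmap c' p) $ k $ l *
             jacobian c c' p $ k $ i * jacobian c c' p $ l $ j))"

text \<open>\<open>christoffel g x i j k\<close> is the Christoffel symbol of the second kind with upper index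
  \<open>i\<close> and lower indices \<open>j\<close>, \<open>k\<close>.\<close>

definition christoffel :: "(real^'k \<Rightarrow> real^'k^'k) \<Rightarrow> real^'k \<Rightarrow> 'k::finite \<Rightarrow> 'k \<Rightarrow> 'k \<Rightarrow> real" where
  "christoffel g x i j k =
     (\<Sum>r\<in>UNIV. matrix_inv (g x) $ i $ r *
        (partial j (\<lambda>z. g z $ r $ k) x + partial k (\<lambda>z. g z $ r $ j) x
          - partial r (\<lambda>z. g z $ j $ k) x)) / 2"

section \<open>The first-order jet space\<close>

text \<open>Jet coordinates are triples \<open>(t, x, y)\<close>, where \<open>y $ \<alpha> $ i\<close> is the coordinate written
  \<open>x\<close> with upper index \<open>i\<close> and lower index \<open>\<alpha>\<close>. Tangent vectors of the jet space, expressed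
  in such coordinates, have the same type.\<close>

type_synonym ('p, 'n) jetc = "(real^'p) \<times> (real^'n) \<times> (real^'n^'p)"

abbreviation tco :: "('p::finite, 'n::finite) jetc \<Rightarrow> real^'p" where "tco u \<equiv> fst u"
abbreviation xco :: "('p::finite, 'n::finite) jetc \<Rightarrow> real^'n" where "xco u \<equiv> fst (snd u)"
abbreviation yco :: "('p::finite, 'n::finite) jetc \<Rightarrow> real^'n^'p" where "yco u \<equiv> snd (snd u)"

definition smooth_near ::
  "('a, 'p::finite) mfd \<Rightarrow> ('b, 'n::finite) mfd \<Rightarrow> 'a \<Rightarrow> ('a \<Rightarrow> 'b) \<Rightarrow> bool" where
  "smooth_near T M t f \<longleftrightarrow>
     (\<exists>W. openin (mtop T) W \<and> t \<in> W \<and> continuous_map (subtopology (mtop T) W) (mtop M) f \<and>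
        (\<forall>c\<in>atlas T. \<forall>d\<in>atlas M.
           smooth_on (cmap c ` {s \<in> W \<inter> cdom c. f s \<in> cdom d}) (cmap d \<circ> f \<circ> cinv c)))"

definition germs :: "('a, 'p::finite) mfd \<Rightarrow> ('b, 'n::finite) mfd \<Rightarrow> ('a \<times> ('a \<Rightarrow> 'b)) set" where
  "germs T M = {(t, f). t \<in> topspace (mtop T) \<and> smooth_near T M t f}"

definition jet_equiv ::
  "('a, 'p::finite) mfd \<Rightarrow> ('b, 'n::finite) mfd \<Rightarrow>
   (('a \<times> ('a \<Rightarrow> 'b)) \<times> ('a \<times> ('a \<Rightarrow> 'b))) set" where
  "jet_equiv T M =
     {((t, f), (s, g)). (t, f) \<in> germs T M \<and> (s, g) \<in> germs T M \<and> s = t \<and> f t = g t \<and>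
        (\<forall>c\<in>atlas T. \<forall>d\<in>atlas M. t \<in> cdom c \<and> f t \<in> cdom d \<longrightarrow>
           frechet_derivative (cmap d \<circ> f \<circ> cinv c) (at (cmap c t)) =
           frechet_derivative (cmap d \<circ> g \<circ> cinv c) (at (cmap c t)))}"

definition J1 ::
  "('a, 'p::finite) mfd \<Rightarrow> ('b, 'n::finite) mfd \<Rightarrow> ('a \<times> ('a \<Rightarrow> 'b)) set set" where
  "J1 T M = germs T M // jet_equiv T M"

definition jet_coords ::
  "('a, 'p::finite) chart \<Rightarrow> ('b, 'n::finite) chart \<Rightarrow> ('a \<times> ('a \<Rightarrow> 'b)) set \<Rightarrow> ('p, 'n) jetc" where
  "jet_coords c d j =
     (let (t, f) = (SOME r. r \<in> j) in
        (cmap c t, cmap d (f t),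
         \<chi> \<alpha> i. partial \<alpha> (\<lambda>s. cmap d (f (cinv c s)) $ i) (cmap c t)))"

definition jet_dom ::
  "('a, 'p::finite) mfd \<Rightarrow> ('b, 'n::finite) mfd \<Rightarrow> ('a, 'p) chart \<Rightarrow> ('b, 'n) chart \<Rightarrow>
   ('a \<times> ('a \<Rightarrow> 'b)) set set" where
  "jet_dom T M c d = {j \<in> J1 T M. \<exists>(t, f)\<in>j. t \<in> cdom c \<and> f t \<in> cdom d}"

definition jet_img :: "('a, 'p::finite) chart \<Rightarrow> ('b, 'n::finite) chart \<Rightarrow> ('p, 'n) jetc set" where
  "jet_img c d = cimg c \<times> cimg d \<times> UNIV"

definition pd_t :: "'p \<Rightarrow> (('p::finite, 'n::finite) jetc \<Rightarrow> real) \<Rightarrow> ('p, 'n) jetc \<Rightarrow> real" where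
  "pd_t \<beta> f u = frechet_derivative f (at u) (axis \<beta> 1, 0, 0)"

definition pd_x :: "'n \<Rightarrow> (('p::finite, 'n::finite) jetc \<Rightarrow> real) \<Rightarrow> ('p, 'n) jetc \<Rightarrow> real" where
  "pd_x j f u = frechet_derivative f (at u) (0, axis j 1, 0)"

definition pd_y :: "'p \<Rightarrow> 'n \<Rightarrow> (('p::finite, 'n::finite) jetc \<Rightarrow> real) \<Rightarrow> ('p, 'n) jetc \<Rightarrow> real" where
  "pd_y \<gamma> k f u = frechet_derivative f (at u) (0, 0, axis \<gamma> (axis k 1))"

section \<open>Vertical d-tensors\<close>

text \<open>A d-tensor \<open>X\<close> is the family of its local components: \<open>X c d u $ \<alpha> $ i\<close> is the component
  with upper index \<open>i\<close> and lower index \<open>\<alpha>\<close>, in the charts \<open>c\<close>, \<open>d\<close>, at the jet coordinates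
  \<open>u\<close>.\<close>

type_synonym ('a, 'p, 'b, 'n) dtensor =
  "('a, 'p) chart \<Rightarrow> ('b, 'n) chart \<Rightarrow> ('p, 'n) jetc \<Rightarrow> real^'n^'p"

definition d_tensor ::
  "('a, 'p::finite) mfd \<Rightarrow> ('b, 'n::finite) mfd \<Rightarrow> ('a, 'p, 'b, 'n) dtensor \<Rightarrow> bool" where
  "d_tensor T M X \<longleftrightarrow>
     (\<forall>c\<in>atlas T. \<forall>d\<in>atlas M. smooth_on (jet_img c d) (X c d)) \<and>
     (\<forall>c\<in>atlas T. \<forall>d\<in>atlas M. \<forall>c'\<in>atlas T. \<forall>d'\<in>atlas M.
        \<forall>j\<in>jet_dom T M c d \<inter> jet_dom T M c' d'. \<forall>(t, f)\<in>j. \<forall>\<beta> k.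
          X c' d' (jet_coords c' d' j) $ \<beta> $ k =
            (\<Sum>\<alpha>\<in>UNIV. \<Sum>i\<in>UNIV. jacobian d d' (f t) $ k $ i * jacobian c' c t $ \<alpha> $ \<beta> *
               X c d (jet_coords c d j) $ \<alpha> $ i))"

definition y_independent ::
  "('a, 'p::finite) mfd \<Rightarrow> ('b, 'n::finite) mfd \<Rightarrow> ('a, 'p, 'b, 'n) dtensor \<Rightarrow> bool" where
  "y_independent T M X \<longleftrightarrow>
     (\<forall>c\<in>atlas T. \<forall>d\<in>atlas M. \<forall>t\<in>cimg c. \<forall>x\<in>cimg d. \<forall>y y'. X c d (t, x, y) = X c d (t, x, y'))"

section \<open>The space attached to a PDE system and its geometry\<close>

text \<open>In the following, \<open>h\<close>, \<open>g\<close> and \<open>X\<close> are the local components, in fixed charts, of the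
  metric on the source, of the metric on the target (written \<open>\<phi>\<close> in the space below) and of the
  d-tensor.\<close>

definition edm_lagrangian ::
  "(real^'p \<Rightarrow> real^'p^'p) \<Rightarrow> (real^'n \<Rightarrow> real^'n^'n) \<Rightarrow>
   (('p::finite, 'n::finite) jetc \<Rightarrow> real^'n^'p) \<Rightarrow> ('p, 'n) jetc \<Rightarrow> real" where
  "edm_lagrangian h g X u =
     (\<Sum>\<alpha>\<in>UNIV. \<Sum>\<beta>\<in>UNIV. \<Sum>i\<in>UNIV. \<Sum>j\<in>UNIV.
        matrix_inv (h (tco u)) $ \<alpha> $ \<beta> * g (xco u) $ i $ j *
        (yco u $ \<alpha> $ i - X u $ \<alpha> $ i) * (yco u $ \<beta> $ j - X u $ \<beta> $ j))"

text \<open>The global Lagrangian is the real function on the jet space given by the above formula in all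
  charts; the values in different charts agree by the transformation laws.\<close>

definition PDEsEDML ::
  "('a, 'p::finite) mfd \<Rightarrow> ('a, 'p) metric \<Rightarrow> ('b, 'n::finite) mfd \<Rightarrow> ('b, 'n) metric \<Rightarrow>
   ('a, 'p, 'b, 'n) dtensor \<Rightarrow>
   ('a \<times> ('a \<Rightarrow> 'b)) set set \<times> (('a \<times> ('a \<Rightarrow> 'b)) set \<Rightarrow> real)" where
  "PDEsEDML T h M \<phi> X =
     (J1 T M,
      \<lambda>j. THE r. \<forall>c\<in>atlas T. \<forall>d\<in>atlas M. j \<in> jet_dom T M c d \<longrightarrow>
                   r = edm_lagrangian (h c) (\<phi> d) (X c d) (jet_coords c d j))"

text \<open>Covariant derivatives of the components of \<open>X\<close>: \<open>X_cov\<close> is the horizontal one (along the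
  target) and \<open>X_cov_t\<close> is the temporal derivative of \<open>X_cov\<close>. Arguments are ordered as: lower
  source index, upper target index, differentiation indices.\<close>

definition X_cov ::
  "(real^'n \<Rightarrow> real^'n^'n) \<Rightarrow> (('p::finite, 'n::finite) jetc \<Rightarrow> real^'n^'p) \<Rightarrow>
   'p \<Rightarrow> 'n \<Rightarrow> 'n \<Rightarrow> ('p, 'n) jetc \<Rightarrow> real" where
  "X_cov g X \<alpha> i j u =
     pd_x j (\<lambda>v. X v $ \<alpha> $ i) u + (\<Sum>m\<in>UNIV. X u $ \<alpha> $ m * christoffel g (xco u) i m j)"

definition X_cov_t ::
  "(real^'p \<Rightarrow> real^'p^'p) \<Rightarrow> (real^'n \<Rightarrow> real^'n^'n) \<Rightarrow>
   (('p::finite, 'n::finite) jetc \<Rightarrow> real^'n^'p) \<Rightarrow>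
   'p \<Rightarrow> 'n \<Rightarrow> 'n \<Rightarrow> 'p \<Rightarrow> ('p, 'n) jetc \<Rightarrow> real" where
  "X_cov_t h g X \<alpha> i j \<beta> u =
     pd_t \<beta> (X_cov g X \<alpha> i j) u - (\<Sum>\<mu>\<in>UNIV. X_cov g X \<mu> i j u * christoffel h (tco u) \<mu> \<alpha> \<beta>)"

text \<open>The canonical nonlinear connection, with arguments ordered as: upper target index, lower source
  index, last lower index.\<close>

definition M_conn ::
  "(real^'p \<Rightarrow> real^'p^'p) \<Rightarrow> 'n \<Rightarrow> 'p \<Rightarrow> 'p \<Rightarrow> ('p::finite, 'n::finite) jetc \<Rightarrow> real" where
  "M_conn h i \<alpha> \<beta> u = - (\<Sum>\<gamma>\<in>UNIV. christoffel h (tco u) \<gamma> \<alpha> \<beta> * yco u $ \<gamma> $ i)"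

definition N_conn ::
  "(real^'n \<Rightarrow> real^'n^'n) \<Rightarrow> (('p::finite, 'n::finite) jetc \<Rightarrow> real^'n^'p) \<Rightarrow>
   'n \<Rightarrow> 'p \<Rightarrow> 'n \<Rightarrow> ('p, 'n) jetc \<Rightarrow> real" where
  "N_conn g X i \<alpha> j u =
     (\<Sum>k\<in>UNIV. christoffel g (xco u) i j k * yco u $ \<alpha> $ k)
     - (X_cov g X \<alpha> i j u
        - (\<Sum>r\<in>UNIV. \<Sum>s\<in>UNIV. matrix_inv (g (xco u)) $ i $ r * X_cov g X \<alpha> s r u * g (xco u) $ s $ j)) / 2"

definition delta_x ::
  "(real^'n \<Rightarrow> real^'n^'n) \<Rightarrow> (('p::finite, 'n::finite) jetc \<Rightarrow> real^'n^'p) \<Rightarrow>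
   'n \<Rightarrow> (('p, 'n) jetc \<Rightarrow> real) \<Rightarrow> ('p, 'n) jetc \<Rightarrow> real" where
  "delta_x g X j f u =
     pd_x j f u - (\<Sum>\<beta>\<in>UNIV. \<Sum>l\<in>UNIV. N_conn g X l \<beta> j u * pd_y \<beta> l f u)"

definition h_deflection ::
  "(real^'n \<Rightarrow> real^'n^'n) \<Rightarrow> (('p::finite, 'n::finite) jetc \<Rightarrow> real^'n^'p) \<Rightarrow>
   'n \<Rightarrow> 'p \<Rightarrow> 'n \<Rightarrow> ('p, 'n) jetc \<Rightarrow> real" where
  "h_deflection g X m \<mu> j u =
     delta_x g X j (\<lambda>v. yco v $ \<mu> $ m) u
     + (\<Sum>l\<in>UNIV. yco u $ \<mu> $ l * christoffel g (xco u) m l j)"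

definition D_defl ::
  "(real^'p \<Rightarrow> real^'p^'p) \<Rightarrow> (real^'n \<Rightarrow> real^'n^'n) \<Rightarrow>
   (('p::finite, 'n::finite) jetc \<Rightarrow> real^'n^'p) \<Rightarrow> 'p \<Rightarrow> 'n \<Rightarrow> 'n \<Rightarrow> ('p, 'n) jetc \<Rightarrow> real" where
  "D_defl h g X \<alpha> i j u =
     (\<Sum>\<mu>\<in>UNIV. \<Sum>m\<in>UNIV. matrix_inv (h (tco u)) $ \<alpha> $ \<mu> * g (xco u) $ i $ m * h_deflection g X m \<mu> j u)"

section \<open>The electromagnetic 2-form\<close>

definition em_comp ::
  "(real^'p \<Rightarrow> real^'p^'p) \<Rightarrow> (real^'n \<Rightarrow> real^'n^'n) \<Rightarrow>
   (('p::finite, 'n::finite) jetc \<Rightarrow> real^'n^'p) \<Rightarrow> 'p \<Rightarrow> 'n \<Rightarrow> 'n \<Rightarrow> ('p, 'n) jetc \<Rightarrow> real" where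
  "em_comp h g X \<alpha> i j u = (D_defl h g X \<alpha> i j u - D_defl h g X \<alpha> j i u) / 2"

definition wedge :: "('v \<Rightarrow> real) \<Rightarrow> ('v \<Rightarrow> real) \<Rightarrow> 'v \<Rightarrow> 'v \<Rightarrow> real" where
  "wedge a b v w = a v * b w - a w * b v"

text \<open>The coframe covectors \<open>dx\<close> and \<open>\<delta>y\<close>, evaluated at a tangent vector \<open>v\<close> in jet
  coordinates.\<close>

definition dx_form :: "'n \<Rightarrow> ('p::finite, 'n::finite) jetc \<Rightarrow> real" where
  "dx_form j v = xco v $ j"

definition dely_form ::
  "(real^'p \<Rightarrow> real^'p^'p) \<Rightarrow> (real^'n \<Rightarrow> real^'n^'n) \<Rightarrow>
   (('p::finite, 'n::finite) jetc \<Rightarrow> real^'n^'p) \<Rightarrow>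
   'n \<Rightarrow> 'p \<Rightarrow> ('p, 'n) jetc \<Rightarrow> ('p, 'n) jetc \<Rightarrow> real" where
  "dely_form h g X i \<alpha> u v =
     yco v $ \<alpha> $ i + (\<Sum>\<beta>\<in>UNIV. M_conn h i \<alpha> \<beta> u * tco v $ \<beta>)
     + (\<Sum>j\<in>UNIV. N_conn g X i \<alpha> j u * xco v $ j)"

definition em_form ::
  "(real^'p \<Rightarrow> real^'p^'p) \<Rightarrow> (real^'n \<Rightarrow> real^'n^'n) \<Rightarrow>
   (('p::finite, 'n::finite) jetc \<Rightarrow> real^'n^'p) \<Rightarrow>
   ('p, 'n) jetc \<Rightarrow> ('p, 'n) jetc \<Rightarrow> ('p, 'n) jetc \<Rightarrow> real" where
  "em_form h g X u v w =
     (\<Sum>\<alpha>\<in>UNIV. \<Sum>i\<in>UNIV. \<Sum>j\<in>UNIV.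
        em_comp h g X \<alpha> i j u * wedge (dely_form h g X i \<alpha> u) (dx_form j) v w)"

text \<open>Covariant derivatives of components \<open>F \<alpha> i j\<close> with upper source index \<open>\<alpha>\<close> and lower target
  indices \<open>i\<close>, \<open>j\<close>: temporal, horizontal and vertical.\<close>

definition F_cov_t ::
  "(real^'p \<Rightarrow> real^'p^'p) \<Rightarrow> ('p \<Rightarrow> 'n \<Rightarrow> 'n \<Rightarrow> ('p::finite, 'n::finite) jetc \<Rightarrow> real) \<Rightarrow>
   'p \<Rightarrow> 'n \<Rightarrow> 'n \<Rightarrow> 'p \<Rightarrow> ('p, 'n) jetc \<Rightarrow> real" where
  "F_cov_t h F \<alpha> i j \<beta> u =
     pd_t \<beta> (F \<alpha> i j) u + (\<Sum>\<mu>\<in>UNIV. F \<mu> i j u * christoffel h (tco u) \<alpha> \<mu> \<beta>)"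

definition F_cov_x ::
  "(real^'n \<Rightarrow> real^'n^'n) \<Rightarrow> ('p \<Rightarrow> 'n \<Rightarrow> 'n \<Rightarrow> ('p::finite, 'n::finite) jetc \<Rightarrow> real) \<Rightarrow>
   'p \<Rightarrow> 'n \<Rightarrow> 'n \<Rightarrow> 'n \<Rightarrow> ('p, 'n) jetc \<Rightarrow> real" where
  "F_cov_x g F \<alpha> i j k u =
     pd_x k (F \<alpha> i j) u - (\<Sum>m\<in>UNIV. F \<alpha> m j u * christoffel g (xco u) m i k)
     - (\<Sum>m\<in>UNIV. F \<alpha> i m u * christoffel g (xco u) m j k)"

definition F_cov_y ::
  "('p \<Rightarrow> 'n \<Rightarrow> 'n \<Rightarrow> ('p::finite, 'n::finite) jetc \<Rightarrow> real) \<Rightarrow>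
   'p \<Rightarrow> 'n \<Rightarrow> 'n \<Rightarrow> 'p \<Rightarrow> 'n \<Rightarrow> ('p, 'n) jetc \<Rightarrow> real" where
  "F_cov_y F \<alpha> i j \<gamma> k u = pd_y \<gamma> k (F \<alpha> i j) u"

definition alt_sum :: "('n \<Rightarrow> 'n \<Rightarrow> real) \<Rightarrow> 'n \<Rightarrow> 'n \<Rightarrow> real" where
  "alt_sum E i j = E i j - E j i"

definition cyclic_sum :: "('n \<Rightarrow> 'n \<Rightarrow> 'n \<Rightarrow> real) \<Rightarrow> 'n \<Rightarrow> 'n \<Rightarrow> 'n \<Rightarrow> real" where
  "cyclic_sum E i j k = E i j k + E j k i + E k i j"

end

theory Submission
  imports Defs
begin

text \<open>In a pair of charts the horizontal deflection tensor is half the skew part of the covariant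
  derivative of \<open>X\<close>, since the Christoffel terms of the nonlinear connection and of the
  deflection cancel. Lowering the target index gives (i), and makes the components, for a fixed source
  index, the exterior derivative of the 1-forms \<open>\<phi>\<^sub>i\<^sub>m X\<^sup>m\<close> on the target,
  contracted with the inverse of \<open>h\<close>. The second Maxwell equation is then the symmetry of
  second derivatives; the Christoffel symbols drop out of the cyclic sum because they are symmetric
  and the components are skew. The first equation follows from (i), because the inverse of \<open>h\<close>
  is covariantly constant and \<open>\<phi>\<close> does not depend on \<open>t\<close>; in the third every summand
  vanishes.\<close>

section \<open>Directional derivatives\<close>

lemma frechet_derivative_diff:
  assumes "f differentiable (at u)" "g differentiable (at u)"
  shows "frechet_derivative (\<lambda>x. f x - g x) (at u) v =
         frechet_derivative f (at u) v - frechet_derivative g (at u) v"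
proof -
  have "((\<lambda>x. f x - g x) has_derivative
      (\<lambda>v. frechet_derivative f (at u) v - frechet_derivative g (at u) v)) (at u)"
    using assms by (intro has_derivative_diff) (auto simp: frechet_derivative_works)
  from frechet_derivative_at[OF this, symmetric] show ?thesis by simp
qed

lemma frechet_derivative_mult:
  fixes f g :: "'a::real_normed_vector \<Rightarrow> real"
  assumes "f differentiable (at u)" "g differentiable (at u)"
  shows "frechet_derivative (\<lambda>x. f x * g x) (at u) v =
         frechet_derivative f (at u) v * g u + f u * frechet_derivative g (at u) v"
proof -
  have "((\<lambda>x. f x * g x) has_derivative
      (\<lambda>v. f u * frechet_derivative g (at u) v + frechet_derivative f (at u) v * g u)) (at u)"
    using assms by (intro has_derivative_mult) (auto simp: frechet_derivative_works)
  from frechet_derivative_at[OF this, symmetric] show ?thesis by simp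
qed

lemma frechet_derivative_sum:
  assumes "\<And>i. i \<in> I \<Longrightarrow> f i differentiable (at u)"
  shows "frechet_derivative (\<lambda>x. \<Sum>i\<in>I. f i x) (at u) v =
         (\<Sum>i\<in>I. frechet_derivative (f i) (at u) v)"
proof -
  have "((\<lambda>x. \<Sum>i\<in>I. f i x) has_derivative
      (\<lambda>v. \<Sum>i\<in>I. frechet_derivative (f i) (at u) v)) (at u)"
    using assms by (intro has_derivative_sum) (auto simp: frechet_derivative_works)
  from frechet_derivative_at[OF this, symmetric] show ?thesis by simp
qed

lemma frechet_derivative_bounded_linear:
  assumes "bounded_linear L" "f differentiable (at u)"
  shows "(\<lambda>x. L (f x)) differentiable (at u)"
    and "frechet_derivative (\<lambda>x. L (f x)) (at u) v = L (frechet_derivative f (at u) v)"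
proof -
  have *: "((\<lambda>x. L (f x)) has_derivative (\<lambda>v. L (frechet_derivative f (at u) v))) (at u)"
    by (rule bounded_linear.has_derivative[OF assms(1) assms(2)[unfolded frechet_derivative_works]])
  then show "(\<lambda>x. L (f x)) differentiable (at u)"
    by (rule differentiableI)
  show "frechet_derivative (\<lambda>x. L (f x)) (at u) v = L (frechet_derivative f (at u) v)"
    using frechet_derivative_at[OF *, symmetric] by simp
qed

text \<open>The chain rule with a linear inner map, meant for the projections of jet coordinates: a
  function of \<open>t\<close> alone or of \<open>x\<close> alone is differentiated through its own
  chart.\<close>

lemma frechet_derivative_comp_bounded_linear:
  assumes "bounded_linear L" "f differentiable (at (L u))"
  shows "(\<lambda>x. f (L x)) differentiable (at u)"
    and "frechet_derivative (\<lambda>x. f (L x)) (at u) v = frechet_derivative f (at (L u)) (L v)"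
proof -
  have L: "(L has_derivative L) (at u)"
    using assms(1) by (rule bounded_linear_imp_has_derivative)
  have *: "((\<lambda>x. f (L x)) has_derivative (\<lambda>v. frechet_derivative f (at (L u)) (L v))) (at u)"
    using diff_chain_at[OF L, of f "frechet_derivative f (at (L u))"] assms(2)
    by (simp add: frechet_derivative_works o_def)
  then show "(\<lambda>x. f (L x)) differentiable (at u)"
    by (rule differentiableI)
  show "frechet_derivative (\<lambda>x. f (L x)) (at u) v = frechet_derivative f (at (L u)) (L v)"
    using frechet_derivative_at[OF *, symmetric] by simp
qed

lemma differentiable_transform_within_open:
  assumes "f differentiable (at x)" "open S" "x \<in> S" "\<And>y. y \<in> S \<Longrightarrow> f y = g y"
  shows "g differentiable (at x)"
  using has_derivative_transform_within_open[OF assms(1)[unfolded frechet_derivative_works] assms(2,3)]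
    assms(4) by (intro differentiableI) auto

text \<open>Serves the products over permutations in the Leibniz formula for the
  determinant.\<close>

lemma differentiable_prod:
  fixes f :: "'i \<Rightarrow> 'a::real_normed_vector \<Rightarrow> real"
  assumes "\<And>i. i \<in> I \<Longrightarrow> f i differentiable (at u)"
  shows "(\<lambda>x. \<Prod>i\<in>I. f i x) differentiable (at u)"
  using assms
  by (intro differentiableI[OF has_derivative_prod[where f' = "\<lambda>i. frechet_derivative (f i) (at u)"]])
     (auto simp: frechet_derivative_works)

text \<open>Restriction to a line turns a directional derivative into a one-variable derivative, to
  which the mean value theorem applies.\<close>

lemma has_real_derivative_along_line:
  fixes f :: "'a::real_normed_vector \<Rightarrow> real"
  assumes "f differentiable (at (p + a *\<^sub>R v))"
  shows "((\<lambda>r. f (p + r *\<^sub>R v)) has_real_derivative frechet_derivative f (at (p + a *\<^sub>R v)) v) (at a)"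
proof -
  let ?f' = "frechet_derivative f (at (p + a *\<^sub>R v))"
  have 1: "((\<lambda>r. p + r *\<^sub>R v) has_derivative (\<lambda>r. r *\<^sub>R v)) (at a)"
    by (auto intro!: derivative_eq_intros)
  have 2: "(f has_derivative ?f') (at (p + a *\<^sub>R v))"
    using assms by (simp add: frechet_derivative_works)
  have "((\<lambda>r. f (p + r *\<^sub>R v)) has_derivative (\<lambda>r. ?f' (r *\<^sub>R v))) (at a)"
    using diff_chain_at[OF 1 2] by (simp add: o_def)
  moreover have "?f' (r *\<^sub>R v) = ?f' v * r" for r
    using linear_frechet_derivative[OF assms] by (simp add: linear_cmul)
  ultimately show ?thesis
    by (simp add: has_field_derivative_def)
qed

lemma frechet_derivative_zero_along_line:
  fixes f :: "'a::real_normed_vector \<Rightarrow> real"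
  assumes "f differentiable (at u)" "\<And>r. f (u + r *\<^sub>R v) = f u"
  shows "frechet_derivative f (at u) v = 0"
proof -
  have "((\<lambda>r. f (u + r *\<^sub>R v)) has_real_derivative frechet_derivative f (at u) v) (at 0)"
    using has_real_derivative_along_line[of f u 0 v] assms(1) by simp
  then show ?thesis
    unfolding assms(2) using DERIV_const DERIV_unique by blast
qed

text \<open>Young's form of the symmetry of second derivatives: the second difference quotient tends to
  either iterated derivative, by the mean value theorem applied along \<open>v\<close> and the
  differentiability of the first derivative at the point.\<close>

lemma second_difference_tendsto:
  fixes f :: "'a::real_normed_vector \<Rightarrow> real"
  assumes "open U" "u \<in> U" "\<And>x. x \<in> U \<Longrightarrow> f differentiable (at x)"
    and "(\<lambda>x. frechet_derivative f (at x) v) differentiable (at u)"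
  shows "((\<lambda>s. (f (u + s *\<^sub>R v + s *\<^sub>R w) - f (u + s *\<^sub>R v) - f (u + s *\<^sub>R w) + f u) / s\<^sup>2)
           \<longlongrightarrow> frechet_derivative (\<lambda>x. frechet_derivative f (at x) v) (at u) w) (at_right 0)"
    (is "(?q \<longlongrightarrow> ?P' w) _")
proof (rule tendstoI)
  fix e :: real assume e: "e > 0"
  define P where "P = (\<lambda>x. frechet_derivative f (at x) v)"
  have P: "(P has_derivative ?P') (at u)"
    using assms(4) unfolding P_def by (simp add: frechet_derivative_works)
  \<comment> \<open>The remainders \<open>R1\<close> and \<open>R2\<close> below together contribute
    \<open>2 * norm v + norm w\<close>; the added 1 keeps \<open>C\<close> positive when
    \<open>v\<close> and \<open>w\<close> vanish. With \<open>\<epsilon> = e / (2 * C)\<close> the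
    final bound is \<open>e / 2\<close>.\<close>
  define C where "C = 2 * norm v + norm w + 1"
  have C: "C > 0" by (simp add: C_def add_nonneg_pos)
  define \<epsilon> where "\<epsilon> = e / (2 * C)"
  have \<epsilon>: "\<epsilon> > 0" using e C by (simp add: \<epsilon>_def)
  obtain \<delta> where \<delta>: "\<delta> > 0"
    and R: "\<And>y. norm (y - u) < \<delta> \<Longrightarrow> norm (P y - P u - ?P' (y - u)) \<le> \<epsilon> * norm (y - u)"
    using P[unfolded has_derivative_at_alt] \<epsilon> by blast
  obtain r where r: "r > 0" "ball u r \<subseteq> U"
    using assms(1,2) openE by blast
  \<comment> \<open>Below \<open>s0\<close> the whole parallelogram with sides
    \<open>s *\<^sub>R v\<close> and \<open>s *\<^sub>R w\<close> at \<open>u\<close> lies in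
    \<open>U\<close> and in the region where the estimate \<open>R\<close> holds.\<close>
  define s0 where "s0 = min \<delta> r / C"
  have s0: "s0 > 0" using \<delta> r C by (simp add: s0_def)
  have "dist (?q s) (?P' w) < e" if s: "0 < s" "s < s0" for s
  proof -
    have sC: "s * C < min \<delta> r" using s C by (simp add: s0_def pos_less_divide_eq)
    have nrm: "norm (a *\<^sub>R v + b *\<^sub>R w) \<le> s * (norm v + norm w)"
      if "0 \<le> a" "a \<le> s" "0 \<le> b" "b \<le> s" for a b
      using that norm_triangle_ineq[of "a *\<^sub>R v" "b *\<^sub>R w"]
        mult_right_mono[of a s "norm v"] mult_right_mono[of b s "norm w"]
      by (simp add: algebra_simps)
    have small: "norm (a *\<^sub>R v + b *\<^sub>R w) < min \<delta> r"
      if "0 \<le> a" "a \<le> s" "0 \<le> b" "b \<le> s" for a b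
    proof -
      have "s * (norm v + norm w) \<le> s * C"
        using s by (intro mult_left_mono) (auto simp: C_def)
      then show ?thesis using nrm[OF that] sC by linarith
    qed
    have inU: "u + a *\<^sub>R v + b *\<^sub>R w \<in> U" if "0 \<le> a" "a \<le> s" "0 \<le> b" "b \<le> s" for a b
    proof -
      have "dist u (u + a *\<^sub>R v + b *\<^sub>R w) = norm (a *\<^sub>R v + b *\<^sub>R w)"
        by (metis add.assoc add_diff_cancel_left' dist_commute dist_norm)
      then show ?thesis using small[OF that] r(2) by (auto simp: subset_eq)
    qed
    \<comment> \<open>The increment of \<open>f\<close> along \<open>w\<close>, as a function of the
      position along \<open>v\<close>: its own increment from 0 to \<open>s\<close> is the numerator
      of the quotient.\<close>
    define \<psi> where "\<psi> = (\<lambda>a. f (u + s *\<^sub>R w + a *\<^sub>R v) - f (u + a *\<^sub>R v))"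
    have "(\<psi> has_real_derivative P (u + s *\<^sub>R w + a *\<^sub>R v) - P (u + a *\<^sub>R v)) (at a)"
      if "0 \<le> a" "a \<le> s" for a
      unfolding \<psi>_def P_def
      using that s inU[of a 0] inU[of a s]
      by (intro DERIV_diff has_real_derivative_along_line assms(3)) (auto simp: algebra_simps)
    from MVT2[OF s(1), of \<psi>, OF this]
    obtain \<xi> where \<xi>: "0 < \<xi>" "\<xi> < s"
      and mvt: "\<psi> s - \<psi> 0 = s * (P (u + s *\<^sub>R w + \<xi> *\<^sub>R v) - P (u + \<xi> *\<^sub>R v))"
      by auto
    \<comment> \<open>Both values of \<open>P\<close> are expanded to first order at
      \<open>u\<close>; their linear parts differ by exactly \<open>s * ?P' w\<close>.\<close>
    define R1 where "R1 = P (u + s *\<^sub>R w + \<xi> *\<^sub>R v) - P u - ?P' (\<xi> *\<^sub>R v + s *\<^sub>R w)"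
    define R2 where "R2 = P (u + \<xi> *\<^sub>R v) - P u - ?P' (\<xi> *\<^sub>R v)"
    have "\<bar>R1\<bar> \<le> \<epsilon> * norm (\<xi> *\<^sub>R v + s *\<^sub>R w)"
      using R[of "u + s *\<^sub>R w + \<xi> *\<^sub>R v"] small[of \<xi> s] \<xi> s by (simp add: R1_def algebra_simps)
    also have "\<dots> \<le> \<epsilon> * (s * (norm v + norm w))"
      using nrm[of \<xi> s] \<xi> s \<epsilon> by (intro mult_left_mono) auto
    finally have R1: "\<bar>R1\<bar> \<le> \<epsilon> * (s * (norm v + norm w))" .
    have "\<bar>R2\<bar> \<le> \<epsilon> * norm (\<xi> *\<^sub>R v)"
      using R[of "u + \<xi> *\<^sub>R v"] small[of \<xi> 0] \<xi> s by (simp add: R2_def algebra_simps)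
    also have "\<dots> \<le> \<epsilon> * (s * norm v)"
      using \<xi> \<epsilon> by (intro mult_left_mono) (auto simp: mult_right_mono)
    finally have R2: "\<bar>R2\<bar> \<le> \<epsilon> * (s * norm v)" .
    have lin: "?P' (\<xi> *\<^sub>R v + s *\<^sub>R w) = ?P' (\<xi> *\<^sub>R v) + s * ?P' w"
      using has_derivative_linear[OF P] by (simp add: linear_add linear_cmul)
    have "?q s = (\<psi> s - \<psi> 0) / s\<^sup>2"
      by (simp add: \<psi>_def algebra_simps)
    also have "\<psi> s - \<psi> 0 = s * (s * ?P' w + (R1 - R2))"
      unfolding mvt R1_def R2_def lin by (simp add: algebra_simps)
    also have "\<dots> / s\<^sup>2 = ?P' w + (R1 - R2) / s"
      using s by (simp add: field_simps power2_eq_square)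
    finally have "?q s - ?P' w = (R1 - R2) / s"
      by simp
    then have "\<bar>?q s - ?P' w\<bar> = \<bar>R1 - R2\<bar> / s"
      using s by simp
    also have "\<dots> \<le> (\<epsilon> * (s * (norm v + norm w)) + \<epsilon> * (s * norm v)) / s"
      using R1 R2 s by (intro divide_right_mono) linarith+
    also have "\<dots> = \<epsilon> * (2 * norm v + norm w)"
      using s by (simp add: field_simps)
    also have "\<dots> \<le> \<epsilon> * C"
      using \<epsilon> by (simp add: C_def)
    also have "\<dots> < e"
      using e C by (simp add: \<epsilon>_def)
    finally show ?thesis by (simp add: dist_real_def)
  qed
  then show "eventually (\<lambda>s. dist (?q s) (?P' w) < e) (at_right 0)"
    using s0 by (auto simp: eventually_at_right_field)
qed

text \<open>The second difference quotient is symmetric in \<open>v\<close> and \<open>w\<close>, so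
  both iterated derivatives are limits of one and the same function.\<close>

lemma frechet_derivative_commute:
  fixes f :: "'a::real_normed_vector \<Rightarrow> real"
  assumes "open U" "u \<in> U" "\<And>x. x \<in> U \<Longrightarrow> f differentiable (at x)"
    and "(\<lambda>x. frechet_derivative f (at x) v) differentiable (at u)"
    and "(\<lambda>x. frechet_derivative f (at x) w) differentiable (at u)"
  shows "frechet_derivative (\<lambda>x. frechet_derivative f (at x) v) (at u) w =
         frechet_derivative (\<lambda>x. frechet_derivative f (at x) w) (at u) v"
proof (rule tendsto_unique)
  show "((\<lambda>s. (f (u + s *\<^sub>R v + s *\<^sub>R w) - f (u + s *\<^sub>R v) - f (u + s *\<^sub>R w) + f u) / s\<^sup>2)
           \<longlongrightarrow> frechet_derivative (\<lambda>x. frechet_derivative f (at x) v) (at u) w) (at_right 0)"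
    by (rule second_difference_tendsto) (use assms in auto)
  have "((\<lambda>s. (f (u + s *\<^sub>R w + s *\<^sub>R v) - f (u + s *\<^sub>R w) - f (u + s *\<^sub>R v) + f u) / s\<^sup>2)
           \<longlongrightarrow> frechet_derivative (\<lambda>x. frechet_derivative f (at x) w) (at u) v) (at_right 0)"
    by (rule second_difference_tendsto) (use assms in auto)
  then show "((\<lambda>s. (f (u + s *\<^sub>R v + s *\<^sub>R w) - f (u + s *\<^sub>R v) - f (u + s *\<^sub>R w) + f u) / s\<^sup>2)
           \<longlongrightarrow> frechet_derivative (\<lambda>x. frechet_derivative f (at x) w) (at u) v) (at_right 0)"
    by (simp add: algebra_simps)
qed simp

section \<open>Functions of class C^k on an open set\<close>

lemma Ck_on_cong:
  assumes "open S" "\<And>x. x \<in> S \<Longrightarrow> f x = g x"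
  shows "Ck_on k S f \<longleftrightarrow> Ck_on k S g"
  using assms(2)
proof (induction k arbitrary: f g)
  case 0
  then show ?case by (simp cong: continuous_on_cong)
next
  case (Suc k)
  \<comment> \<open>Since \<open>S\<close> is open, the derivative at a point of \<open>S\<close> is
    determined by the values on \<open>S\<close>. The implication is proved for arbitrary functions
    so that it serves both directions.\<close>
  have imp: "Ck_on (Suc k) S g" if f: "Ck_on (Suc k) S f" and eq: "\<And>x. x \<in> S \<Longrightarrow> f x = g x"
    for f g :: "'a \<Rightarrow> 'b"
  proof -
    have d: "g differentiable (at x)" if "x \<in> S" for x
      using f that by (intro differentiable_transform_within_open[OF _ assms(1) that eq]) simp_all
    have "frechet_derivative f (at x) = frechet_derivative g (at x)" if "x \<in> S" for x
      using f that eq assms(1) by (intro frechet_derivative_transform_within_open) auto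
    then have "Ck_on k S (\<lambda>x. frechet_derivative f (at x) v) =
        Ck_on k S (\<lambda>x. frechet_derivative g (at x) v)" for v
      by (intro Suc.IH) simp
    with f d show ?thesis by simp
  qed
  show ?case
  proof
    show "Ck_on (Suc k) S g" if "Ck_on (Suc k) S f"
      using that Suc.prems by (rule imp)
    show "Ck_on (Suc k) S f" if "Ck_on (Suc k) S g"
      using that Suc.prems[symmetric] by (rule imp)
  qed
qed

text \<open>A bounded linear map commutes with differentiation, so each order reduces to the
  previous one for a directional derivative of \<open>f\<close>. The commutation is available on
  \<open>S\<close> only, hence the appeal to \<open>Ck_on_cong\<close>.\<close>

lemma smooth_on_bounded_linear:
  assumes "open S" "bounded_linear L" "smooth_on S f"
  shows "smooth_on S (\<lambda>x. L (f x))"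
proof -
  have "Ck_on k S f \<Longrightarrow> Ck_on k S (\<lambda>x. L (f x))" for k
  proof (induction k arbitrary: f)
    case 0
    then show ?case using assms(2) by (simp add: bounded_linear.continuous_on)
  next
    case (Suc k)
    have "Ck_on k S (\<lambda>x. frechet_derivative (\<lambda>x. L (f x)) (at x) v)" for v
    proof -
      have "Ck_on k S (\<lambda>x. L (frechet_derivative f (at x) v))"
        using Suc.prems by (intro Suc.IH) simp
      moreover have "frechet_derivative (\<lambda>x. L (f x)) (at x) v = L (frechet_derivative f (at x) v)"
        if "x \<in> S" for x
        using that Suc.prems by (intro frechet_derivative_bounded_linear(2)[OF assms(2)]) simp
      ultimately show ?thesis
        using Ck_on_cong[OF assms(1), of "\<lambda>x. frechet_derivative (\<lambda>x. L (f x)) (at x) v"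
          "\<lambda>x. L (frechet_derivative f (at x) v)" k] by blast
    qed
    then show ?case
      using Suc.prems frechet_derivative_bounded_linear(1)[OF assms(2)] by auto
  qed
  then show ?thesis using assms(3) by (simp add: smooth_on_def)
qed

lemma smooth_on_component:
  fixes f :: "'a::real_normed_vector \<Rightarrow> real^'k^'l"
  assumes "open S" "smooth_on S f"
  shows "smooth_on S (\<lambda>x. f x $ i $ j)"
  using assms
  by (intro smooth_on_bounded_linear[where L = "\<lambda>y. y $ i $ j"])
     (auto intro!: bounded_linear_compose[OF bounded_linear_vec_nth] bounded_linear_vec_nth)

lemma smooth_on_differentiable:
  assumes "smooth_on S f" "x \<in> S"
  shows "f differentiable (at x)"
    and "(\<lambda>x. frechet_derivative f (at x) v) differentiable (at x)"
proof -
  have "Ck_on (Suc (Suc 0)) S f" using assms(1) by (simp only: smooth_on_def)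
  then show "f differentiable (at x)" "(\<lambda>x. frechet_derivative f (at x) v) differentiable (at x)"
    using assms(2) by auto
qed

section \<open>The inverse of a matrix-valued function\<close>

lemma matrix_inv_works:
  fixes A :: "real^'n^'n"
  assumes "invertible A"
  shows "A ** matrix_inv A = mat 1" "matrix_inv A ** A = mat 1"
  using someI_ex[OF assms[unfolded invertible_def]] unfolding matrix_inv_def by auto

text \<open>Column \<open>l\<close> of the inverse solves the linear system with right-hand side
  \<open>axis l 1\<close>, so Cramer's rule applies. The entries of the inverse become rational
  functions of the entries of \<open>A\<close>, which can be differentiated.\<close>

lemma matrix_inv_cramer:
  fixes A :: "real^'n^'n"
  assumes "invertible A"
  shows "matrix_inv A $ k $ l = det (\<chi> i j. if j = k then axis l 1 $ i else A $ i $ j) / det A"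
proof -
  have "A *v (matrix_inv A *v axis l 1) = axis l 1"
    by (simp add: matrix_vector_mul_assoc matrix_inv_works(1)[OF assms])
  then have "matrix_inv A *v axis l 1 =
      (\<chi> k. det (\<chi> i j. if j = k then axis l 1 $ i else A $ i $ j) / det A)"
    using assms by (subst (asm) cramer) (auto simp: invertible_det_nz)
  moreover have "(matrix_inv A *v axis l 1) $ k = matrix_inv A $ k $ l"
    by (simp add: matrix_vector_mul_component inner_axis)
  ultimately show ?thesis by simp
qed

lemma differentiable_det:
  fixes A :: "'a::real_normed_vector \<Rightarrow> real^'n^'n"
  assumes "\<And>i j. (\<lambda>x. A x $ i $ j) differentiable (at u)"
  shows "(\<lambda>x. det (A x)) differentiable (at u)"
  unfolding det_def using assms
  by (auto intro!: differentiable_sum differentiable_mult differentiable_prod)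

lemma differentiable_matrix_inv:
  fixes A :: "'a::real_normed_vector \<Rightarrow> real^'n^'n"
  assumes "open U" "u \<in> U" "\<And>x. x \<in> U \<Longrightarrow> invertible (A x)"
    and "\<And>i j. (\<lambda>x. A x $ i $ j) differentiable (at u)"
  shows "(\<lambda>x. matrix_inv (A x) $ k $ l) differentiable (at u)"
proof -
  \<comment> \<open>Cramer's quotient agrees with the entry of the inverse on all of the open set
    \<open>U\<close>, not just at \<open>u\<close>, so differentiability carries over.\<close>
  define q where
    "q = (\<lambda>x. det (\<chi> i j. if j = k then axis l 1 $ i else A x $ i $ j) / det (A x))"
  have "(\<lambda>x. (\<chi> i j. if j = k then axis l 1 $ i else A x $ i $ j) $ a $ b) differentiable (at u)" for a b
    using assms(4) by (cases "b = k") simp_all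
  then have "q differentiable (at u)"
    unfolding q_def using assms(2-4)
    by (intro differentiable_divide differentiable_det) (auto simp: invertible_det_nz)
  moreover have "q x = matrix_inv (A x) $ k $ l" if "x \<in> U" for x
    using that assms(3) by (simp add: q_def matrix_inv_cramer)
  ultimately show ?thesis
    by (rule differentiable_transform_within_open[OF _ assms(1,2)])
qed

text \<open>Lowering and then raising an index is the identity: the inner product of
  \<open>P\<close> and \<open>Q\<close> is a Kronecker delta.\<close>

lemma sum_contract:
  fixes f :: "'n::finite \<Rightarrow> real"
  assumes "\<And>r. (\<Sum>m\<in>UNIV. P m * Q m r) = (if i = r then 1 else 0)"
  shows "(\<Sum>m\<in>UNIV. P m * (\<Sum>r\<in>UNIV. Q m r * f r)) = f i"
proof -
  have "(\<Sum>m\<in>UNIV. P m * (\<Sum>r\<in>UNIV. Q m r * f r)) = (\<Sum>r\<in>UNIV. (\<Sum>m\<in>UNIV. P m * Q m r) * f r)"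
    unfolding sum_distrib_left sum_distrib_right by (subst sum.swap) (simp add: mult.assoc)
  also have "\<dots> = f i"
    by (simp add: assms if_distrib[of "\<lambda>c. c * _"] cong: if_cong)
  finally show ?thesis .
qed

section \<open>Metrics in a chart\<close>

locale metric_chart =
  fixes S :: "(real^'k::finite) set" and g :: "real^'k \<Rightarrow> real^'k^'k"
  assumes open_dom: "open S" and smooth: "smooth_on S g"
    and transpose: "x \<in> S \<Longrightarrow> transpose (g x) = g x"
    and pos: "x \<in> S \<Longrightarrow> v \<noteq> 0 \<Longrightarrow> v \<bullet> (g x *v v) > 0"
begin

abbreviation "ginv x \<equiv> matrix_inv (g x)"
abbreviation "dg k i j x \<equiv> partial k (\<lambda>z. g z $ i $ j) x"

lemma g_sym:
  assumes "x \<in> S" shows "g x $ i $ j = g x $ j $ i"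
proof -
  have "transpose (g x) $ j $ i = g x $ j $ i" by (simp add: transpose[OF assms])
  then show ?thesis by (simp add: transpose_def)
qed

text \<open>Positive definiteness leaves no nonzero vector in the kernel.\<close>

lemma invertible_g:
  assumes "x \<in> S" shows "invertible (g x)"
proof -
  have "v = 0" if "g x *v v = 0" for v
    using pos[OF assms, of v] that by fastforce
  then show ?thesis
    using invertible_left_inverse matrix_left_invertible_ker by blast
qed

lemma g_ginv: "x \<in> S \<Longrightarrow> (\<Sum>m\<in>UNIV. g x $ i $ m * ginv x $ m $ r) = (if i = r then 1 else 0)"
  using matrix_inv_works(1)[OF invertible_g]
  by (simp add: matrix_matrix_mult_def mat_def vec_eq_iff)

lemma ginv_g: "x \<in> S \<Longrightarrow> (\<Sum>m\<in>UNIV. ginv x $ i $ m * g x $ m $ r) = (if i = r then 1 else 0)"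
  using matrix_inv_works(2)[OF invertible_g]
  by (simp add: matrix_matrix_mult_def mat_def vec_eq_iff)

lemma g_ginv_contract:
  "x \<in> S \<Longrightarrow> (\<Sum>m\<in>UNIV. g x $ i $ m * (\<Sum>r\<in>UNIV. ginv x $ m $ r * f r)) = f i"
  by (rule sum_contract) (rule g_ginv)

lemma ginv_g_contract:
  "x \<in> S \<Longrightarrow> (\<Sum>m\<in>UNIV. ginv x $ i $ m * (\<Sum>r\<in>UNIV. g x $ m $ r * f r)) = f i"
  by (rule sum_contract) (rule ginv_g)

text \<open>Transposing \<open>ginv x ** g x = mat 1\<close> shows that the transpose of the inverse
  is a right inverse of the symmetric matrix \<open>g x\<close>; a right inverse is the
  inverse.\<close>

lemma ginv_sym:
  assumes "x \<in> S" shows "ginv x $ i $ j = ginv x $ j $ i"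
proof -
  have "transpose (g x) ** transpose (ginv x) = mat 1"
    by (simp add: matrix_inv_works(2)[OF invertible_g[OF assms]] flip: matrix_transpose_mul)
  then have "ginv x ** (g x ** transpose (ginv x)) = ginv x"
    by (simp add: transpose[OF assms])
  then have "transpose (ginv x) = ginv x"
    by (simp add: matrix_mul_assoc matrix_inv_works(2)[OF invertible_g[OF assms]])
  then have "transpose (ginv x) $ j $ i = ginv x $ j $ i" by simp
  then show ?thesis by (simp add: transpose_def)
qed

lemma differentiable_g: "x \<in> S \<Longrightarrow> (\<lambda>z. g z $ i $ j) differentiable (at x)"
  using smooth_on_differentiable(1)[OF smooth_on_component[OF open_dom smooth]] .

lemma differentiable_dg: "x \<in> S \<Longrightarrow> dg k i j differentiable (at x)"
  unfolding partial_def
  using smooth_on_differentiable(2)[OF smooth_on_component[OF open_dom smooth]] .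

lemma differentiable_ginv: "x \<in> S \<Longrightarrow> (\<lambda>z. ginv z $ i $ j) differentiable (at x)"
  using differentiable_matrix_inv[OF open_dom] differentiable_g invertible_g by blast

lemma differentiable_christoffel:
  "x \<in> S \<Longrightarrow> (\<lambda>z. christoffel g z i j k) differentiable (at x)"
  unfolding christoffel_def
  using differentiable_ginv differentiable_dg
  by (auto intro!: differentiable_divide differentiable_sum differentiable_mult differentiable_add
      differentiable_diff)

lemma dg_sym:
  assumes "x \<in> S" shows "dg k i j x = dg k j i x"
  unfolding partial_def
  using frechet_derivative_transform_within_open[OF differentiable_g[OF assms] open_dom assms g_sym]
  by simp

lemma christoffel_sym: "x \<in> S \<Longrightarrow> christoffel g x i j k = christoffel g x i k j"
  unfolding christoffel_def by (simp add: dg_sym[of x _ j k] add.commute)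

text \<open>Lowering the upper index cancels the inverse metric and leaves the Christoffel symbol of
  the first kind.\<close>

lemma christoffel_lower:
  assumes "x \<in> S"
  shows "(\<Sum>m\<in>UNIV. g x $ i $ m * christoffel g x m j k) = (dg j i k x + dg k i j x - dg i j k x) / 2"
proof -
  have "(\<Sum>m\<in>UNIV. g x $ i $ m * christoffel g x m j k) =
      (\<Sum>m\<in>UNIV. g x $ i $ m *
        (\<Sum>r\<in>UNIV. ginv x $ m $ r * (dg j r k x + dg k r j x - dg r j k x))) / 2"
    by (simp add: christoffel_def flip: sum_divide_distrib)
  then show ?thesis by (simp only: g_ginv_contract[OF assms])
qed

text \<open>Covariant constancy of the metric: in the sum of two symbols of the first kind, the
  derivatives in the directions \<open>i\<close> and \<open>j\<close> cancel by symmetry of the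
  metric.\<close>

lemma metric_compatible:
  assumes "x \<in> S"
  shows "dg k i j x =
    (\<Sum>m\<in>UNIV. g x $ i $ m * christoffel g x m j k) + (\<Sum>m\<in>UNIV. g x $ j $ m * christoffel g x m i k)"
  unfolding christoffel_lower[OF assms]
  using dg_sym[OF assms, of j i k] dg_sym[OF assms, of k i j] dg_sym[OF assms, of i j k]
  by (simp add: field_simps)

text \<open>Covariant constancy of the inverse metric. The product of metric and inverse is
  constant; the Leibniz rule is solved for the derivative of the inverse, and the derivative of the
  metric is replaced by Christoffel symbols.\<close>

lemma inverse_metric_compatible:
  assumes x: "x \<in> S"
  shows "partial k (\<lambda>z. ginv z $ a $ b) x =
    - (\<Sum>m\<in>UNIV. ginv x $ a $ m * christoffel g x b m k)
    - (\<Sum>m\<in>UNIV. ginv x $ m $ b * christoffel g x a m k)"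
proof -
  let ?di = "\<lambda>m. partial k (\<lambda>z. ginv z $ m $ b) x"
  have product: "(\<Sum>m\<in>UNIV. g x $ i $ m * ?di m) = - (\<Sum>m\<in>UNIV. ginv x $ m $ b * dg k i m x)" for i
  proof -
    have "(\<lambda>z. \<Sum>m\<in>UNIV. g z $ i $ m * ginv z $ m $ b) differentiable (at x)"
      using differentiable_g[OF x] differentiable_ginv[OF x]
      by (intro differentiable_sum) (auto intro: differentiable_mult)
    then have "frechet_derivative (\<lambda>z. \<Sum>m\<in>UNIV. g z $ i $ m * ginv z $ m $ b) (at x) =
        frechet_derivative (\<lambda>z. if i = b then 1 else 0::real) (at x)"
      by (rule frechet_derivative_transform_within_open[OF _ open_dom x]) (rule g_ginv)
    then have "partial k (\<lambda>z. \<Sum>m\<in>UNIV. g z $ i $ m * ginv z $ m $ b) x = 0"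
      by (simp add: partial_def)
    moreover have "partial k (\<lambda>z. \<Sum>m\<in>UNIV. g z $ i $ m * ginv z $ m $ b) x =
        (\<Sum>m\<in>UNIV. dg k i m x * ginv x $ m $ b + g x $ i $ m * ?di m)"
      unfolding partial_def using differentiable_g[OF x] differentiable_ginv[OF x]
      by (simp add: frechet_derivative_sum frechet_derivative_mult)
    ultimately show ?thesis
      by (simp add: sum.distrib mult.commute eq_neg_iff_add_eq_0 add.commute)
  qed
  have "?di a = (\<Sum>i\<in>UNIV. ginv x $ a $ i * (\<Sum>m\<in>UNIV. g x $ i $ m * ?di m))"
    by (rule ginv_g_contract[OF x, symmetric])
  also have "\<dots> = - (\<Sum>i\<in>UNIV. \<Sum>m\<in>UNIV. ginv x $ a $ i * (ginv x $ m $ b *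
      (\<Sum>r\<in>UNIV. g x $ i $ r * christoffel g x r m k)))
      - (\<Sum>i\<in>UNIV. \<Sum>m\<in>UNIV. ginv x $ a $ i * (ginv x $ m $ b *
      (\<Sum>r\<in>UNIV. g x $ m $ r * christoffel g x r i k)))"
    unfolding product metric_compatible[OF x]
    by (simp add: sum_distrib_left sum.distrib sum_negf sum_subtractf algebra_simps)
  \<comment> \<open>In this double sum \<open>ginv\<close> contracts with \<open>g\<close> over
    \<open>i\<close>; in the other one below it does so over \<open>m\<close>, after an exchange of
    the indices of \<open>ginv\<close>.\<close>
  also have "(\<Sum>i\<in>UNIV. \<Sum>m\<in>UNIV. ginv x $ a $ i * (ginv x $ m $ b *
      (\<Sum>r\<in>UNIV. g x $ i $ r * christoffel g x r m k))) =
      (\<Sum>m\<in>UNIV. ginv x $ m $ b *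
        (\<Sum>i\<in>UNIV. ginv x $ a $ i * (\<Sum>r\<in>UNIV. g x $ i $ r * christoffel g x r m k)))"
    by (subst sum.swap) (simp add: sum_distrib_left mult.left_commute)
  also have "\<dots> = (\<Sum>m\<in>UNIV. ginv x $ m $ b * christoffel g x a m k)"
    by (simp only: ginv_g_contract[OF x])
  also have "(\<Sum>i\<in>UNIV. \<Sum>m\<in>UNIV. ginv x $ a $ i * (ginv x $ m $ b *
      (\<Sum>r\<in>UNIV. g x $ m $ r * christoffel g x r i k))) =
      (\<Sum>i\<in>UNIV. ginv x $ a $ i *
        (\<Sum>m\<in>UNIV. ginv x $ b $ m * (\<Sum>r\<in>UNIV. g x $ m $ r * christoffel g x r i k)))"
    by (simp add: sum_distrib_left ginv_sym[OF x, of _ b])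
  also have "\<dots> = (\<Sum>i\<in>UNIV. ginv x $ a $ i * christoffel g x b i k)"
    by (simp only: ginv_g_contract[OF x])
  finally show ?thesis by simp
qed

end

section \<open>The electromagnetic components in a pair of charts\<close>

lemma bounded_linear_xco: "bounded_linear (\<lambda>u. xco u)"
  by (intro bounded_linear_compose[OF bounded_linear_fst bounded_linear_snd])

lemma bounded_linear_yco: "bounded_linear (\<lambda>u. yco u $ \<mu> $ m)"
  by (intro bounded_linear_compose[OF bounded_linear_vec_nth]
      bounded_linear_compose[OF bounded_linear_snd bounded_linear_snd])

lemma frechet_derivative_yco: "frechet_derivative (\<lambda>v. yco v $ \<mu> $ m) (at u) e = yco e $ \<mu> $ m"
  by (rule fun_cong[OF frechet_derivative_at[OF bounded_linear_imp_has_derivative[OF bounded_linear_yco]],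
        symmetric])

locale edm_chart = source: metric_chart A h + target: metric_chart B g
  for A :: "(real^'p::finite) set" and h :: "real^'p \<Rightarrow> real^'p^'p"
    and B :: "(real^'n::finite) set" and g :: "real^'n \<Rightarrow> real^'n^'n" +
  fixes X :: "('p, 'n) jetc \<Rightarrow> real^'n^'p"
  assumes smooth_X: "smooth_on (A \<times> B \<times> UNIV) X"
    and X_y: "t \<in> A \<Longrightarrow> x \<in> B \<Longrightarrow> X (t, x, y) = X (t, x, y')"
begin

abbreviation "U \<equiv> A \<times> B \<times> (UNIV :: (real^'n^'p) set)"
abbreviation "G i j u \<equiv> g (xco u) $ i $ j"
abbreviation "Hinv \<alpha> \<beta> u \<equiv> matrix_inv (h (tco u)) $ \<alpha> $ \<beta>"
abbreviation "Xc \<equiv> X_cov g X"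

definition X_low :: "'p \<Rightarrow> 'n \<Rightarrow> ('p, 'n) jetc \<Rightarrow> real" where
  "X_low \<mu> i u = (\<Sum>m\<in>UNIV. G i m u * X u $ \<mu> $ m)"

lemma open_U: "open U"
  by (intro open_Times source.open_dom target.open_dom open_UNIV)

lemma differentiable_G: "u \<in> U \<Longrightarrow> (\<lambda>v. G i j v) differentiable (at u)"
  by (rule frechet_derivative_comp_bounded_linear(1)[OF bounded_linear_xco])
     (auto intro: target.differentiable_g)

lemma derivative_G:
  "u \<in> U \<Longrightarrow> frechet_derivative (\<lambda>v. G i j v) (at u) e =
    frechet_derivative (\<lambda>z. g z $ i $ j) (at (xco u)) (xco e)"
  by (rule frechet_derivative_comp_bounded_linear(2)[OF bounded_linear_xco])
     (auto intro: target.differentiable_g)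

text \<open>\<open>X_low\<close> will be differentiated twice, which involves second derivatives of
  the metric. The formula \<open>derivative_G\<close> holds on the open set \<open>U\<close>, so
  differentiability transfers.\<close>

lemma differentiable_derivative_G:
  assumes "u \<in> U"
  shows "(\<lambda>v. frechet_derivative (\<lambda>v. G i j v) (at v) e) differentiable (at u)"
proof (rule differentiable_transform_within_open[OF _ open_U assms])
  have "(\<lambda>z. frechet_derivative (\<lambda>z. g z $ i $ j) (at z) (xco e)) differentiable (at (xco u))"
    using assms
    by (intro smooth_on_differentiable(2)[OF smooth_on_component[OF target.open_dom target.smooth]]) auto
  then show "(\<lambda>v. frechet_derivative (\<lambda>z. g z $ i $ j) (at (xco v)) (xco e)) differentiable (at u)"
    by (rule frechet_derivative_comp_bounded_linear(1)[OF bounded_linear_xco])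
qed (simp only: derivative_G)

lemma differentiable_christoffel_target:
  "u \<in> U \<Longrightarrow> (\<lambda>v. christoffel g (xco v) i j k) differentiable (at u)"
  by (rule frechet_derivative_comp_bounded_linear(1)[OF bounded_linear_xco])
     (auto intro: target.differentiable_christoffel)

lemma differentiable_Hinv: "u \<in> U \<Longrightarrow> (\<lambda>v. Hinv \<alpha> \<mu> v) differentiable (at u)"
  by (rule frechet_derivative_comp_bounded_linear(1)[OF bounded_linear_fst])
     (auto intro: source.differentiable_ginv)

lemma derivative_Hinv:
  "u \<in> U \<Longrightarrow> frechet_derivative (\<lambda>v. Hinv \<alpha> \<mu> v) (at u) e =
    frechet_derivative (\<lambda>z. matrix_inv (h z) $ \<alpha> $ \<mu>) (at (tco u)) (tco e)"
  by (rule frechet_derivative_comp_bounded_linear(2)[OF bounded_linear_fst])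
     (auto intro: source.differentiable_ginv)

text \<open>The inverse of \<open>h\<close> depends on \<open>t\<close> only, so its derivative sees
  only the \<open>t\<close> part of the direction.\<close>

lemma derivative_Hinv_spatial:
  assumes "u \<in> U" "tco e = 0"
  shows "frechet_derivative (\<lambda>v. Hinv \<alpha> \<mu> v) (at u) e = 0"
proof -
  have "linear (frechet_derivative (\<lambda>z. matrix_inv (h z) $ \<alpha> $ \<mu>) (at (tco u)))"
    using assms by (intro linear_frechet_derivative source.differentiable_ginv) auto
  then show ?thesis
    by (simp add: derivative_Hinv[OF assms(1)] assms(2) linear_0)
qed

lemma differentiable_X: "u \<in> U \<Longrightarrow> (\<lambda>v. X v $ \<mu> $ m) differentiable (at u)"
  using smooth_on_differentiable(1)[OF smooth_on_component[OF open_U smooth_X]] .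

lemma differentiable_derivative_X:
  "u \<in> U \<Longrightarrow> (\<lambda>v. frechet_derivative (\<lambda>v. X v $ \<mu> $ m) (at v) e) differentiable (at u)"
  using smooth_on_differentiable(2)[OF smooth_on_component[OF open_U smooth_X]] .

lemma differentiable_Xc: "u \<in> U \<Longrightarrow> Xc \<mu> m j differentiable (at u)"
  unfolding X_cov_def pd_x_def
  by (intro differentiable_add differentiable_sum ballI differentiable_mult differentiable_derivative_X
      differentiable_X differentiable_christoffel_target finite_class.finite_UNIV)

lemma differentiable_X_low: "u \<in> U \<Longrightarrow> X_low \<mu> i differentiable (at u)"
  unfolding X_low_def
  by (intro differentiable_sum ballI differentiable_mult differentiable_X differentiable_G
      finite_class.finite_UNIV)

lemma derivative_X_low:
  assumes "u \<in> U"
  shows "frechet_derivative (X_low \<mu> i) (at u) e =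
    (\<Sum>m\<in>UNIV. frechet_derivative (\<lambda>v. G i m v) (at u) e * X u $ \<mu> $ m
      + G i m u * frechet_derivative (\<lambda>v. X v $ \<mu> $ m) (at u) e)"
proof -
  have eq: "X_low \<mu> i = (\<lambda>u. \<Sum>m\<in>UNIV. G i m u * X u $ \<mu> $ m)"
    by (simp add: fun_eq_iff X_low_def)
  show ?thesis
    unfolding eq
    by (subst frechet_derivative_sum)
       (simp_all add: frechet_derivative_mult differentiable_mult differentiable_X differentiable_G assms)
qed

lemma differentiable_derivative_X_low:
  assumes "u \<in> U"
  shows "(\<lambda>v. frechet_derivative (X_low \<mu> i) (at v) e) differentiable (at u)"
  by (rule differentiable_transform_within_open[OF _ open_U assms derivative_X_low[symmetric]])
     (intro differentiable_sum ballI differentiable_add differentiable_mult differentiable_X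
       differentiable_G differentiable_derivative_X differentiable_derivative_G
       finite_class.finite_UNIV assms)

lemma derivative_X_low_commute:
  "u \<in> U \<Longrightarrow> frechet_derivative (\<lambda>v. frechet_derivative (X_low \<mu> i) (at v) e) (at u) e' =
    frechet_derivative (\<lambda>v. frechet_derivative (X_low \<mu> i) (at v) e') (at u) e"
  using frechet_derivative_commute[OF open_U] differentiable_X_low differentiable_derivative_X_low
  by blast

text \<open>A vertical line keeps \<open>t\<close> and \<open>x\<close> fixed and stays in
  \<open>U\<close>; along it neither the metric nor \<open>X\<close> changes.\<close>

lemma derivative_X_low_vertical:
  assumes "u \<in> U"
  shows "frechet_derivative (X_low \<mu> i) (at u) (0, 0, e) = 0"
proof (rule frechet_derivative_zero_along_line[OF differentiable_X_low[OF assms]])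
  fix r :: real
  obtain t x y where u: "u = (t, x, y)" by (metis prod_cases3)
  show "X_low \<mu> i (u + r *\<^sub>R (0, 0, e)) = X_low \<mu> i u"
    using assms X_y[of t x "y + r *\<^sub>R e" y] by (simp add: X_low_def u)
qed

text \<open>The Christoffel terms of the two covariant derivatives cancel against the derivatives of the
  lowering metric, so the electromagnetic components form an exterior derivative along the target.\<close>

lemma X_cov_curl:
  assumes u: "u \<in> U"
  shows "(\<Sum>m\<in>UNIV. G i m u * Xc \<mu> m j u) - (\<Sum>m\<in>UNIV. G j m u * Xc \<mu> m i u) =
    pd_x j (X_low \<mu> i) u - pd_x i (X_low \<mu> j) u"
proof -
  have x: "xco u \<in> B" using u by auto
  \<comment> \<open>Lowering turns the Christoffel symbols inside \<open>Xc\<close> into symbols of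
    the first kind.\<close>
  have lower: "(\<Sum>m\<in>UNIV. G i m u * Xc \<mu> m j u) =
      (\<Sum>m\<in>UNIV. G i m u * pd_x j (\<lambda>v. X v $ \<mu> $ m) u) +
      (\<Sum>l\<in>UNIV. X u $ \<mu> $ l *
        (target.dg l i j (xco u) + target.dg j i l (xco u) - target.dg i l j (xco u)) / 2)" for i j
  proof -
    have "(\<Sum>m\<in>UNIV. G i m u * (\<Sum>l\<in>UNIV. X u $ \<mu> $ l * christoffel g (xco u) m l j)) =
        (\<Sum>l\<in>UNIV. X u $ \<mu> $ l * (\<Sum>m\<in>UNIV. G i m u * christoffel g (xco u) m l j))"
      unfolding sum_distrib_left by (subst sum.swap) (simp add: mult.left_commute)
    then show ?thesis
      by (simp add: X_cov_def distrib_left sum.distrib target.christoffel_lower[OF x])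
  qed
  have pd: "pd_x j (X_low \<mu> i) u = (\<Sum>m\<in>UNIV. target.dg j i m (xco u) * X u $ \<mu> $ m) +
      (\<Sum>m\<in>UNIV. G i m u * pd_x j (\<lambda>v. X v $ \<mu> $ m) u)" for i j
    by (simp add: pd_x_def derivative_X_low[OF u] derivative_G[OF u] partial_def sum.distrib)
  \<comment> \<open>The derivatives in direction \<open>l\<close> cancel, being symmetric in
    \<open>i\<close> and \<open>j\<close>; the other terms occur twice, which absorbs the factor
    1/2.\<close>
  have "(\<Sum>l\<in>UNIV. X u $ \<mu> $ l *
        (target.dg l i j (xco u) + target.dg j i l (xco u) - target.dg i l j (xco u)) / 2) -
      (\<Sum>l\<in>UNIV. X u $ \<mu> $ l *
        (target.dg l j i (xco u) + target.dg i j l (xco u) - target.dg j l i (xco u)) / 2) =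
      (\<Sum>m\<in>UNIV. target.dg j i m (xco u) * X u $ \<mu> $ m) -
      (\<Sum>m\<in>UNIV. target.dg i j m (xco u) * X u $ \<mu> $ m)"
    unfolding sum_subtractf[symmetric]
    using target.dg_sym[OF x, of _ i j] target.dg_sym[OF x, of i _ j] target.dg_sym[OF x, of j _ i]
    by (intro sum.cong refl) (simp add: field_simps)
  then show ?thesis unfolding lower pd by linarith
qed

text \<open>Lowering \<open>m\<close> cancels the inverse metric in the subtracted term, which
  becomes the first term with \<open>i\<close> and \<open>j\<close> exchanged. \<open>W\<close> is
  arbitrary because both \<open>X_cov\<close> and its temporal derivative are treated this
  way.\<close>

lemma lowered_skew_part:
  assumes "u \<in> U"
  shows "(\<Sum>m\<in>UNIV. G i m u * (W m j - (\<Sum>r\<in>UNIV. \<Sum>s\<in>UNIV.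
      matrix_inv (g (xco u)) $ m $ r * W s r * G s j u))) =
    (\<Sum>m\<in>UNIV. G i m u * W m j) - (\<Sum>m\<in>UNIV. G j m u * W m i)"
proof -
  have x: "xco u \<in> B" using assms by auto
  have "(\<Sum>m\<in>UNIV. G i m u * (\<Sum>r\<in>UNIV. \<Sum>s\<in>UNIV. matrix_inv (g (xco u)) $ m $ r * W s r * G s j u)) =
      (\<Sum>m\<in>UNIV. G i m u * (\<Sum>r\<in>UNIV. matrix_inv (g (xco u)) $ m $ r * (\<Sum>s\<in>UNIV. G j s u * W s r)))"
    by (simp add: sum_distrib_left target.g_sym[OF x, of j] mult_ac)
  also have "\<dots> = (\<Sum>s\<in>UNIV. G j s u * W s i)"
    by (rule target.g_ginv_contract[OF x])
  finally show ?thesis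
    by (simp add: right_diff_distrib sum_subtractf)
qed

section \<open>The deflection tensor and the electromagnetic components\<close>

lemma h_deflection_eq:
  assumes "u \<in> U"
  shows "h_deflection g X m \<mu> j u =
    (Xc \<mu> m j u - (\<Sum>r\<in>UNIV. \<Sum>s\<in>UNIV.
      matrix_inv (g (xco u)) $ m $ r * Xc \<mu> s r u * G s j u)) / 2"
proof -
  have x: "xco u \<in> B" using assms by auto
  \<comment> \<open>The vertical derivatives of a fibre coordinate are Kronecker deltas, so one
    coefficient of the connection survives.\<close>
  have "(\<Sum>\<beta>\<in>UNIV. \<Sum>l\<in>UNIV. N_conn g X l \<beta> j u * pd_y \<beta> l (\<lambda>v. yco v $ \<mu> $ m) u) =
      (\<Sum>\<beta>\<in>UNIV. \<Sum>l\<in>UNIV. if \<beta> = \<mu> then if l = m then N_conn g X l \<beta> j u else 0 else 0)"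
    by (intro sum.cong refl) (auto simp: pd_y_def frechet_derivative_yco axis_def)
  also have "\<dots> = (\<Sum>\<beta>\<in>UNIV. if \<beta> = \<mu> then N_conn g X m \<beta> j u else 0)"
    by (intro sum.cong refl) simp
  also have "\<dots> = N_conn g X m \<mu> j u"
    by simp
  finally have "delta_x g X j (\<lambda>v. yco v $ \<mu> $ m) u = - N_conn g X m \<mu> j u"
    by (simp add: delta_x_def pd_x_def frechet_derivative_yco)
  \<comment> \<open>The Christoffel sum in \<open>N_conn\<close> and the one in the deflection agree
    up to the order of the lower indices and cancel.\<close>
  then show ?thesis
    by (simp add: h_deflection_def N_conn_def target.christoffel_sym[OF x, of m j] mult.commute)
qed

lemma D_defl_eq:
  assumes "u \<in> U"
  shows "D_defl h g X \<alpha> i j u = (\<Sum>\<mu>\<in>UNIV. Hinv \<alpha> \<mu> u / 2 *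
    ((\<Sum>m\<in>UNIV. G i m u * Xc \<mu> m j u) - (\<Sum>m\<in>UNIV. G j m u * Xc \<mu> m i u)))"
proof -
  have "D_defl h g X \<alpha> i j u = (\<Sum>\<mu>\<in>UNIV. Hinv \<alpha> \<mu> u / 2 *
      (\<Sum>m\<in>UNIV. G i m u * (Xc \<mu> m j u - (\<Sum>r\<in>UNIV. \<Sum>s\<in>UNIV.
        matrix_inv (g (xco u)) $ m $ r * Xc \<mu> s r u * G s j u))))"
    by (simp add: D_defl_def h_deflection_eq[OF assms] sum_distrib_left mult.assoc)
  then show ?thesis
    by (simp only: lowered_skew_part[OF assms, where W = "\<lambda>m j. Xc _ m j u"])
qed

text \<open>The lowered deflection is already skew in \<open>i\<close> and \<open>j\<close>, so
  halving its alternation gives it back unchanged.\<close>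

lemma em_comp_eq:
  assumes "u \<in> U"
  shows "em_comp h g X \<alpha> i j u = (\<Sum>\<mu>\<in>UNIV. Hinv \<alpha> \<mu> u / 2 *
    ((\<Sum>m\<in>UNIV. G i m u * Xc \<mu> m j u) - (\<Sum>m\<in>UNIV. G j m u * Xc \<mu> m i u)))"
proof -
  have "D_defl h g X \<alpha> j i u = - D_defl h g X \<alpha> i j u"
    unfolding D_defl_eq[OF assms] sum_negf[symmetric]
    by (intro sum.cong refl) (simp add: algebra_simps)
  then show ?thesis by (simp add: em_comp_def D_defl_eq[OF assms])
qed

lemma em_comp_curl:
  assumes "u \<in> U"
  shows "em_comp h g X \<alpha> i j u =
    (\<Sum>\<mu>\<in>UNIV. Hinv \<alpha> \<mu> u / 2 * (pd_x j (X_low \<mu> i) u - pd_x i (X_low \<mu> j) u))"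
  by (simp only: em_comp_eq[OF assms] X_cov_curl[OF assms])

lemma em_comp_skew: "em_comp h g X \<alpha> i j u = - em_comp h g X \<alpha> j i u"
  by (simp only: em_comp_def minus_divide_left minus_diff_eq)

text \<open>The factor \<open>W\<close> is left open: spatial and vertical derivatives use the curl
  of \<open>X_low\<close>, the temporal one uses the lowered covariant derivatives of
  \<open>X\<close>.\<close>

lemma derivative_em_comp:
  assumes u: "u \<in> U"
    and W: "\<And>\<mu> v. v \<in> U \<Longrightarrow> W \<mu> differentiable (at v)"
    and F: "\<And>v. v \<in> U \<Longrightarrow> em_comp h g X \<alpha> i j v = (\<Sum>\<mu>\<in>UNIV. Hinv \<alpha> \<mu> v / 2 * W \<mu> v)"
  shows "frechet_derivative (em_comp h g X \<alpha> i j) (at u) e =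
    (\<Sum>\<mu>\<in>UNIV. frechet_derivative (\<lambda>v. Hinv \<alpha> \<mu> v) (at u) e / 2 * W \<mu> u
      + Hinv \<alpha> \<mu> u / 2 * frechet_derivative (W \<mu>) (at u) e)"
proof -
  \<comment> \<open>The factor 1/2 is moved to \<open>W\<close> so that the product rule can be
    applied to \<open>Hinv\<close> itself.\<close>
  let ?f = "\<lambda>\<mu> v. Hinv \<alpha> \<mu> v * (1/2 * W \<mu> v)"
  have d: "(\<lambda>v. 1/2 * W \<mu> v) differentiable (at u)" for \<mu>
    using W[OF u] by (intro differentiable_mult differentiable_const)
  have df: "?f \<mu> differentiable (at u)" for \<mu>
    by (intro differentiable_mult differentiable_Hinv u d)
  have "frechet_derivative (\<lambda>v. \<Sum>\<mu>\<in>UNIV. ?f \<mu> v) (at u) =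
      frechet_derivative (em_comp h g X \<alpha> i j) (at u)"
    by (rule frechet_derivative_transform_within_open[OF _ open_U u])
       (use df in \<open>auto simp: F\<close>)
  then have "frechet_derivative (em_comp h g X \<alpha> i j) (at u) e =
      (\<Sum>\<mu>\<in>UNIV. frechet_derivative (?f \<mu>) (at u) e)"
    using df by (simp flip: frechet_derivative_sum)
  then show ?thesis
    unfolding frechet_derivative_mult[OF differentiable_Hinv[OF u] d]
      frechet_derivative_mult[OF differentiable_const W[OF u]]
    by simp
qed

section \<open>The vertical and horizontal Maxwell equations\<close>

lemma derivative_em_comp_spatial:
  assumes u: "u \<in> U" and e: "tco e = 0"
  shows "frechet_derivative (em_comp h g X \<alpha> i j) (at u) e =
    (\<Sum>\<mu>\<in>UNIV. Hinv \<alpha> \<mu> u / 2 *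
      (frechet_derivative (pd_x j (X_low \<mu> i)) (at u) e
        - frechet_derivative (pd_x i (X_low \<mu> j)) (at u) e))"
proof -
  have d: "pd_x j (X_low \<mu> i) differentiable (at v)" if "v \<in> U" for \<mu> i j v
    unfolding pd_x_def using differentiable_derivative_X_low[OF that] .
  show ?thesis
    by (subst derivative_em_comp[OF u _ em_comp_curl])
       (simp_all add: d differentiable_diff frechet_derivative_diff u derivative_Hinv_spatial[OF u e])
qed

text \<open>The components are built from first derivatives of \<open>X_low\<close> and the inverse
  of \<open>h\<close>. The vertical derivative commutes past the horizontal one and then annihilates
  \<open>X_low\<close>.\<close>

lemma em_comp_vertical:
  assumes u: "u \<in> U"
  shows "F_cov_y (em_comp h g X) \<alpha> i j \<gamma> k u = 0"
proof -
  let ?e = "(0, 0, axis \<gamma> (axis k 1)) :: ('p, 'n) jetc"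
  have "frechet_derivative (pd_x j (X_low \<mu> i)) (at u) ?e = 0" for \<mu> i j
  proof -
    have "frechet_derivative (pd_x j (X_low \<mu> i)) (at u) ?e =
        frechet_derivative (\<lambda>v. frechet_derivative (X_low \<mu> i) (at v) ?e) (at u) (0, axis j 1, 0)"
      unfolding pd_x_def by (rule derivative_X_low_commute[OF u])
    \<comment> \<open>The vertical derivative vanishes on the whole open set \<open>U\<close>, so
      its further derivatives vanish as well.\<close>
    also have "\<dots> = frechet_derivative (\<lambda>v. 0) (at u) (0, axis j 1, 0)"
      by (subst frechet_derivative_transform_within_open[OF differentiable_derivative_X_low[OF u] open_U u
            derivative_X_low_vertical]) simp_all
    finally show ?thesis by simp
  qed
  then show ?thesis
    by (simp add: F_cov_y_def pd_y_def derivative_em_comp_spatial[OF u])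
qed

lemma em_comp_bianchi:
  assumes u: "u \<in> U"
  shows "cyclic_sum (\<lambda>i j k. F_cov_x g (em_comp h g X) \<alpha> i j k u) i j k = 0"
proof -
  let ?F = "em_comp h g X"
  define d where "d = (\<lambda>\<mu> i j k. pd_x k (pd_x j (X_low \<mu> i)) u)"
  have x: "xco u \<in> B" using u by auto
  have commute: "d \<mu> i j k = d \<mu> i k j" for \<mu> i j k
    unfolding d_def pd_x_def by (rule derivative_X_low_commute[OF u])
  have pd: "pd_x k (?F \<alpha> i j) u = (\<Sum>\<mu>\<in>UNIV. Hinv \<alpha> \<mu> u / 2 * (d \<mu> i j k - d \<mu> j i k))" for i j k
    unfolding d_def pd_x_def[of k] by (rule derivative_em_comp_spatial[OF u]) simp
  \<comment> \<open>Six second derivatives remain under the sum over \<open>\<mu>\<close>; they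
    cancel in pairs by \<open>commute\<close>.\<close>
  have "pd_x k (?F \<alpha> i j) u + pd_x i (?F \<alpha> j k) u + pd_x j (?F \<alpha> k i) u = 0"
    unfolding pd sum.distrib[symmetric] distrib_left[symmetric]
    by (simp add: commute[of _ i k j] commute[of _ j i k] commute[of _ k j i])
  \<comment> \<open>The second correction term at \<open>(i, j, k)\<close> is minus the first one at
    \<open>(k, i, j)\<close>, so the corrections cancel around the cycle.\<close>
  moreover have "(\<Sum>m\<in>UNIV. ?F \<alpha> i m u * christoffel g (xco u) m j k) =
      - (\<Sum>m\<in>UNIV. ?F \<alpha> m i u * christoffel g (xco u) m k j)" for i j k
    unfolding sum_negf[symmetric] em_comp_skew[of \<alpha> i] target.christoffel_sym[OF x, of _ j k]
    by simp
  ultimately show ?thesis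
    by (simp add: cyclic_sum_def F_cov_x_def)
qed

section \<open>The temporal Maxwell equation\<close>

lemma pd_t_Hinv:
  assumes u: "u \<in> U"
  shows "pd_t \<beta> (\<lambda>v. Hinv \<alpha> \<mu> v) u =
    - (\<Sum>\<nu>\<in>UNIV. Hinv \<alpha> \<nu> u * christoffel h (tco u) \<mu> \<nu> \<beta>)
    - (\<Sum>\<nu>\<in>UNIV. Hinv \<nu> \<mu> u * christoffel h (tco u) \<alpha> \<nu> \<beta>)"
  using source.inverse_metric_compatible[of "tco u" \<beta> \<alpha> \<mu>] u
  by (auto simp: pd_t_def partial_def derivative_Hinv[OF u])

text \<open>The target metric does not depend on \<open>t\<close>, so the temporal derivative passes
  through the lowering of the index.\<close>

lemma pd_t_lowered_Xc:
  assumes u: "u \<in> U"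
  shows "(\<lambda>v. \<Sum>m\<in>UNIV. G i m v * Xc \<mu> m j v) differentiable (at u)"
    and "frechet_derivative (\<lambda>v. \<Sum>m\<in>UNIV. G i m v * Xc \<mu> m j v) (at u) (axis \<beta> 1, 0, 0) =
      (\<Sum>m\<in>UNIV. G i m u * pd_t \<beta> (Xc \<mu> m j) u)"
proof -
  have d: "(\<lambda>v. G i m v * Xc \<mu> m j v) differentiable (at u)" for m
    by (intro differentiable_mult differentiable_G differentiable_Xc u)
  then show "(\<lambda>v. \<Sum>m\<in>UNIV. G i m v * Xc \<mu> m j v) differentiable (at u)"
    by simp
  have "linear (frechet_derivative (\<lambda>z. g z $ i $ m) (at (xco u)))" for m
    using u by (intro linear_frechet_derivative target.differentiable_g) auto
  then have "frechet_derivative (\<lambda>v. G i m v) (at u) (axis \<beta> 1, 0, 0) = 0" for m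
    by (simp add: derivative_G[OF u] linear_0)
  then show "frechet_derivative (\<lambda>v. \<Sum>m\<in>UNIV. G i m v * Xc \<mu> m j v) (at u) (axis \<beta> 1, 0, 0) =
      (\<Sum>m\<in>UNIV. G i m u * pd_t \<beta> (Xc \<mu> m j) u)"
    by (subst frechet_derivative_sum[OF d])
       (simp add: frechet_derivative_mult[OF differentiable_G[OF u] differentiable_Xc[OF u]] pd_t_def)
qed

text \<open>Differentiating the inverse of \<open>h\<close> yields two Christoffel terms. The one at
  the free index \<open>\<alpha>\<close> cancels the correction in \<open>F_cov_t\<close>; the one
  at the summed index supplies the correction in \<open>X_cov_t\<close>.\<close>

lemma F_cov_t_em_comp:
  assumes u: "u \<in> U"
  shows "F_cov_t h (em_comp h g X) \<alpha> i j \<beta> u = (\<Sum>\<mu>\<in>UNIV. Hinv \<alpha> \<mu> u / 2 *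
    ((\<Sum>m\<in>UNIV. G i m u * X_cov_t h g X \<mu> m j \<beta> u)
      - (\<Sum>m\<in>UNIV. G j m u * X_cov_t h g X \<mu> m i \<beta> u)))"
proof -
  let ?\<Gamma> = "\<lambda>\<mu> \<nu>. christoffel h (tco u) \<mu> \<nu> \<beta>"
  define W where
    "W = (\<lambda>\<mu> v. (\<Sum>m\<in>UNIV. G i m v * Xc \<mu> m j v) - (\<Sum>m\<in>UNIV. G j m v * Xc \<mu> m i v))"
  define W' where "W' = (\<lambda>\<mu>. (\<Sum>m\<in>UNIV. G i m u * pd_t \<beta> (Xc \<mu> m j) u)
    - (\<Sum>m\<in>UNIV. G j m u * pd_t \<beta> (Xc \<mu> m i) u))"
  have dW: "W \<mu> differentiable (at v)" if "v \<in> U" for \<mu> v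
    unfolding W_def by (intro differentiable_diff pd_t_lowered_Xc(1) that)
  have F: "em_comp h g X \<alpha> i j v = (\<Sum>\<mu>\<in>UNIV. Hinv \<alpha> \<mu> v / 2 * W \<mu> v)" if "v \<in> U" for \<alpha> v
    unfolding W_def by (rule em_comp_eq[OF that])
  have W': "frechet_derivative (W \<mu>) (at u) (axis \<beta> 1, 0, 0) = W' \<mu>" for \<mu>
    unfolding W_def W'_def frechet_derivative_diff[OF pd_t_lowered_Xc(1)[OF u] pd_t_lowered_Xc(1)[OF u]]
      pd_t_lowered_Xc(2)[OF u] ..
  have "pd_t \<beta> (em_comp h g X \<alpha> i j) u =
      (\<Sum>\<mu>\<in>UNIV. pd_t \<beta> (\<lambda>v. Hinv \<alpha> \<mu> v) u / 2 * W \<mu> u) + (\<Sum>\<mu>\<in>UNIV. Hinv \<alpha> \<mu> u / 2 * W' \<mu>)"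
    unfolding pd_t_def by (subst derivative_em_comp[OF u dW F]) (simp_all add: W' sum.distrib)
  also have "(\<Sum>\<mu>\<in>UNIV. pd_t \<beta> (\<lambda>v. Hinv \<alpha> \<mu> v) u / 2 * W \<mu> u) =
      - (\<Sum>\<mu>\<in>UNIV. \<Sum>\<nu>\<in>UNIV. Hinv \<alpha> \<nu> u / 2 * (?\<Gamma> \<mu> \<nu> * W \<mu> u))
      - (\<Sum>\<mu>\<in>UNIV. \<Sum>\<nu>\<in>UNIV. Hinv \<nu> \<mu> u / 2 * W \<mu> u * ?\<Gamma> \<alpha> \<nu>)"
    unfolding pd_t_Hinv[OF u] sum_negf[symmetric] sum_subtractf[symmetric]
    by (intro sum.cong refl)
       (simp add: diff_divide_distrib left_diff_distrib right_diff_distrib sum_distrib_right sum_distrib_left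
         sum_divide_distrib sum_negf sum_subtractf mult_ac)
  \<comment> \<open>Renaming the summed indices lets \<open>Hinv\<close> be factored out and moves
    the Christoffel symbol onto \<open>W\<close>.\<close>
  also have "(\<Sum>\<mu>\<in>UNIV. \<Sum>\<nu>\<in>UNIV. Hinv \<alpha> \<nu> u / 2 * (?\<Gamma> \<mu> \<nu> * W \<mu> u)) =
      (\<Sum>\<mu>\<in>UNIV. Hinv \<alpha> \<mu> u / 2 * (\<Sum>\<nu>\<in>UNIV. ?\<Gamma> \<nu> \<mu> * W \<nu> u))"
    by (subst sum.swap) (simp only: sum_distrib_left)
  \<comment> \<open>Here the sum over \<open>\<mu>\<close> reassembles an electromagnetic
    component.\<close>
  also have "(\<Sum>\<mu>\<in>UNIV. \<Sum>\<nu>\<in>UNIV. Hinv \<nu> \<mu> u / 2 * W \<mu> u * ?\<Gamma> \<alpha> \<nu>) =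
      (\<Sum>\<mu>\<in>UNIV. em_comp h g X \<mu> i j u * ?\<Gamma> \<alpha> \<mu>)"
    by (subst sum.swap) (simp only: F[OF u] sum_distrib_right)
  finally have "F_cov_t h (em_comp h g X) \<alpha> i j \<beta> u =
      (\<Sum>\<mu>\<in>UNIV. Hinv \<alpha> \<mu> u / 2 * (W' \<mu> - (\<Sum>\<nu>\<in>UNIV. ?\<Gamma> \<nu> \<mu> * W \<nu> u)))"
    by (simp add: F_cov_t_def right_diff_distrib sum_subtractf)
  moreover have "(\<Sum>m\<in>UNIV. G i m u * X_cov_t h g X \<mu> m j \<beta> u) =
      (\<Sum>m\<in>UNIV. G i m u * pd_t \<beta> (Xc \<mu> m j) u)
      - (\<Sum>\<nu>\<in>UNIV. ?\<Gamma> \<nu> \<mu> * (\<Sum>m\<in>UNIV. G i m u * Xc \<nu> m j u))" for \<mu> i j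
    unfolding X_cov_t_def right_diff_distrib sum_subtractf sum_distrib_left
    by (subst (2) sum.swap) (simp add: mult_ac)
  ultimately show ?thesis
    by (simp add: W_def W'_def right_diff_distrib sum_subtractf)
qed

text \<open>After lowering, the expression under the alternate sum is already skew, so alternation
  doubles it and 1/4 becomes the 1/2 of \<open>F_cov_t_em_comp\<close>.\<close>

lemma maxwell_temporal:
  assumes u: "u \<in> U"
  shows "F_cov_t h (em_comp h g X) \<alpha> i j \<beta> u =
    1/4 * alt_sum (\<lambda>i j. \<Sum>\<mu>\<in>UNIV. \<Sum>m\<in>UNIV. Hinv \<alpha> \<mu> u * G i m u *
      (X_cov_t h g X \<mu> m j \<beta> u - (\<Sum>r\<in>UNIV. \<Sum>s\<in>UNIV.
        matrix_inv (g (xco u)) $ m $ r * X_cov_t h g X \<mu> s r \<beta> u * G s j u))) i j"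
proof -
  have E: "(\<Sum>\<mu>\<in>UNIV. \<Sum>m\<in>UNIV. Hinv \<alpha> \<mu> u * G i m u *
      (X_cov_t h g X \<mu> m j \<beta> u - (\<Sum>r\<in>UNIV. \<Sum>s\<in>UNIV.
        matrix_inv (g (xco u)) $ m $ r * X_cov_t h g X \<mu> s r \<beta> u * G s j u))) =
      (\<Sum>\<mu>\<in>UNIV. Hinv \<alpha> \<mu> u * ((\<Sum>m\<in>UNIV. G i m u * X_cov_t h g X \<mu> m j \<beta> u)
        - (\<Sum>m\<in>UNIV. G j m u * X_cov_t h g X \<mu> m i \<beta> u)))" for i j
    unfolding mult.assoc[of "Hinv \<alpha> _ u"] sum_distrib_left[symmetric]
    by (simp only: lowered_skew_part[OF u, where W = "\<lambda>m j. X_cov_t h g X _ m j \<beta> u"])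
  show ?thesis
    unfolding alt_sum_def E F_cov_t_em_comp[OF u] sum_subtractf[symmetric] sum_distrib_left
    by (intro sum.cong refl) (simp add: algebra_simps)
qed

end

section \<open>From points of the jet space to a pair of charts\<close>

lemma jet_coords_mem:
  assumes "j \<in> jet_dom T M c d"
  shows "jet_coords c d j \<in> cimg c \<times> cimg d \<times> UNIV"
proof -
  obtain t f where tf: "(t, f) \<in> j" "t \<in> cdom c" "f t \<in> cdom d"
    using assms unfolding jet_dom_def by blast
  obtain r where r: "j = jet_equiv T M `` {r}"
    using assms unfolding jet_dom_def J1_def quotient_def by blast
  obtain s k where sk: "(SOME r. r \<in> j) = (s, k)" by fastforce
  then have "(s, k) \<in> j" using tf(1) someI[of "\<lambda>r. r \<in> j"] by metis
  \<comment> \<open>\<open>jet_coords\<close> reads an arbitrary representative, while membership in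
    \<open>jet_dom\<close> speaks of some representative; equivalent germs share base point and
    value there.\<close>
  then have "s = t" "k t = f t"
    using tf(1) unfolding r jet_equiv_def by auto
  then show ?thesis
    using tf unfolding jet_coords_def sk by simp
qed

lemma metric_chart_of_riemannian:
  assumes "smooth_manifold M" "riemannian_metric M g" "c \<in> atlas M"
  shows "metric_chart (cimg c) (g c)"
  using assms unfolding smooth_manifold_def riemannian_metric_def by unfold_locales auto

theorem theorem2p3:
  fixes T :: "('a, 'p::finite) mfd" and M :: "('b, 'n::finite) mfd"
    and h :: "('a, 'p) metric" and \<phi> :: "('b, 'n) metric"
    and X :: "('a, 'p, 'b, 'n) dtensor"
    and J :: "('a \<times> ('a \<Rightarrow> 'b)) set set" and L :: "('a \<times> ('a \<Rightarrow> 'b)) set \<Rightarrow> real"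
  assumes T: "connected_smooth_manifold T" and M: "connected_smooth_manifold M"
    and h: "riemannian_metric T h" and \<phi>: "riemannian_metric M \<phi>"
    and X: "d_tensor T M X" and X_indep: "y_independent T M X"
    and space: "(J, L) = PDEsEDML T h M \<phi> X"
  shows "\<forall>c\<in>atlas T. \<forall>d\<in>atlas M. \<forall>j1\<in>J. j1 \<in> jet_dom T M c d \<longrightarrow>
    (let u = jet_coords c d j1;
         F = em_comp (h c) (\<phi> d) (X c d);
         hinv = matrix_inv (h c (tco u));
         g = \<phi> d (xco u);
         ginv = matrix_inv g;
         Xc = X_cov (\<phi> d) (X c d);
         Xct = X_cov_t (h c) (\<phi> d) (X c d)
     in
       ((\<forall>v w. em_form (h c) (\<phi> d) (X c d) u v w =
           (\<Sum>\<alpha>\<in>UNIV. \<Sum>i\<in>UNIV. \<Sum>j\<in>UNIV.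
              F \<alpha> i j u * wedge (dely_form (h c) (\<phi> d) (X c d) i \<alpha> u) (dx_form j) v w)) \<and>
        (\<forall>\<alpha> i j. F \<alpha> i j u =
           (\<Sum>\<mu>\<in>UNIV. hinv $ \<alpha> $ \<mu> / 2 *
              ((\<Sum>m\<in>UNIV. g $ i $ m * Xc \<mu> m j u) - (\<Sum>m\<in>UNIV. g $ j $ m * Xc \<mu> m i u))))) \<and>
       ((\<forall>\<alpha> i j \<beta>. F_cov_t (h c) F \<alpha> i j \<beta> u =
           1/4 * alt_sum (\<lambda>i j. \<Sum>\<mu>\<in>UNIV. \<Sum>m\<in>UNIV. hinv $ \<alpha> $ \<mu> * g $ i $ m *
              (Xct \<mu> m j \<beta> u - (\<Sum>r\<in>UNIV. \<Sum>s\<in>UNIV. ginv $ m $ r * Xct \<mu> s r \<beta> u * g $ s $ j))) i j) \<and>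
        (\<forall>\<alpha> i j k. cyclic_sum (\<lambda>i j k. F_cov_x (\<phi> d) F \<alpha> i j k u) i j k = 0) \<and>
        (\<forall>\<alpha> \<gamma> i j k. cyclic_sum (\<lambda>i j k. F_cov_y F \<alpha> i j \<gamma> k u) i j k = 0)))"
proof (intro ballI impI, goal_cases)
  case (1 c d j1)
  note c = 1(1) and d = 1(2) and u = jet_coords_mem[OF 1(4)]
  interpret source: metric_chart "cimg c" "h c"
    using T h c by (intro metric_chart_of_riemannian) (auto simp: connected_smooth_manifold_def)
  interpret target: metric_chart "cimg d" "\<phi> d"
    using M \<phi> d by (intro metric_chart_of_riemannian) (auto simp: connected_smooth_manifold_def)
  interpret edm_chart "cimg c" "h c" "cimg d" "\<phi> d" "X c d"
  proof
    show "smooth_on (cimg c \<times> cimg d \<times> UNIV) (X c d)"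
      using X c d unfolding d_tensor_def jet_img_def by blast
    show "X c d (t, x, y) = X c d (t, x, y')" if "t \<in> cimg c" "x \<in> cimg d" for t x y y'
      using X_indep c d that unfolding y_independent_def by blast
  qed
  \<comment> \<open>The expression for the 2-form is its definition, and in the vertical equation
    all three summands are zero.\<close>
  show ?case
    unfolding Let_def
    using em_comp_eq[OF u] maxwell_temporal[OF u] em_comp_bianchi[OF u]
    by (intro conjI allI) (simp_all add: em_form_def cyclic_sum_def em_comp_vertical[OF u])
qed

end
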